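(* Let $f\in\mathrm{BMO}(S^1)$ and $\gamma(z)=\frac{z-i}{z+i}$. Then $f\in\mathrm{VMO}(S^1)$ if and only if $f\circ\gamma\in\mathrm{CMO}(\mathbb{R})$.
   Context: $S^1$ is the unit circle; $\gamma$ maps $\mathbb{R}$ onto $S^1\setminus\{1\}$. For an interval or arc $I$, $|I|$ is its length and $f_I$ the mean of $f$ over $I$. $\mathrm{BMO}(\mathbb{R})$ is the space of locally integrable $f$ on $\mathbb{R}$ with $\|f\|_*=\sup_I \frac1{|I|}\int_I|f-f_I|dx<\infty$; $\mathrm{CMO}(\mathbb{R})$ is the closure in $\mathrm{BMO}(\mathbb{R})$, with respect to $\|\cdot\|_*$, of the continuous functions with compact support (functions modulo constants). $\mathrm{BMO}(S^1)$ is defined in the same way with arcs $I\subset S^1$ and arc length, and $\mathrm{VMO}(S^1)$ is the set of $f\in\mathrm{BMO}(S^1)$ with $\lim_{|I|\to0}\frac1{|I|}\int_I|f-f_I|=0$ (uniformly in arcs $I$). *)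

theory Defs
  imports "HOL-Analysis.Analysis"
begin

definition interval_mean :: "(real \<Rightarrow> complex) \<Rightarrow> real \<Rightarrow> real \<Rightarrow> complex" where
  "interval_mean f a b = (1 / (b - a)) *\<^sub>R (LINT x:{a..b}|lebesgue. f x)"

definition mean_osc :: "(real \<Rightarrow> complex) \<Rightarrow> real \<Rightarrow> real \<Rightarrow> real" where
  "mean_osc f a b =
     (1 / (b - a)) * (LINT x:{a..b}|lebesgue. norm (f x - interval_mean f a b))"

definition locally_integrable :: "(real \<Rightarrow> complex) \<Rightarrow> bool" where
  "locally_integrable f \<longleftrightarrow> (\<forall>K. compact K \<longrightarrow> f absolutely_integrable_on K)"

text \<open>Functions are not quotiented by constants: the seminorm below does not see constants,
  and the spaces are sets of functions closed under adding them.\<close>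

definition bmo_norm :: "(real \<Rightarrow> complex) \<Rightarrow> ereal" where
  "bmo_norm f = (SUP (a, b) \<in> {(a, b). a < b}. ereal (mean_osc f a b))"

definition BMO_real :: "(real \<Rightarrow> complex) set" where
  "BMO_real = {f. locally_integrable f \<and> bmo_norm f < \<infinity>}"

definition Cc_real :: "(real \<Rightarrow> complex) set" where
  "Cc_real = {g. continuous_on UNIV g \<and> compact (closure {x. g x \<noteq> 0})}"

definition CMO_real :: "(real \<Rightarrow> complex) set" where
  "CMO_real = {f \<in> BMO_real.
     \<forall>\<epsilon>>0. \<exists>g\<in>Cc_real. bmo_norm (\<lambda>x. f x - g x) < ereal \<epsilon>}"

text \<open>A function on the unit circle is represented by a function on \<^typ>\<open>complex\<close>, of which only
  the values on the circle are used. The arc from \<^term>\<open>cis a\<close> counterclockwise to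
  \<^term>\<open>cis b\<close> is given by its end angles, subject to \<open>a < b \<le> a + 2 * pi\<close>. Since
  \<^const>\<open>cis\<close> is an arc length parametrization, the arc has length \<open>b - a\<close>, and integrals over
  it with respect to arc length are integrals of \<open>t \<mapsto> f (cis t)\<close> over \<open>{a..b}\<close>.\<close>

definition arcs :: "(real \<times> real) set" where
  "arcs = {(a, b). a < b \<and> b \<le> a + 2 * pi}"

definition arc_mean_osc :: "(complex \<Rightarrow> complex) \<Rightarrow> real \<Rightarrow> real \<Rightarrow> real" where
  "arc_mean_osc f a b = mean_osc (\<lambda>t. f (cis t)) a b"

definition circle_integrable :: "(complex \<Rightarrow> complex) \<Rightarrow> bool" where
  "circle_integrable f \<longleftrightarrow> (\<lambda>t. f (cis t)) absolutely_integrable_on {0..2 * pi}"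

definition bmo_norm_circle :: "(complex \<Rightarrow> complex) \<Rightarrow> ereal" where
  "bmo_norm_circle f = (SUP (a, b) \<in> arcs. ereal (arc_mean_osc f a b))"

definition BMO_circle :: "(complex \<Rightarrow> complex) set" where
  "BMO_circle = {f. circle_integrable f \<and> bmo_norm_circle f < \<infinity>}"

definition VMO_circle :: "(complex \<Rightarrow> complex) set" where
  "VMO_circle = {f \<in> BMO_circle.
     \<forall>\<epsilon>>0. \<exists>\<delta>>0. \<forall>(a, b)\<in>arcs. b - a < \<delta> \<longrightarrow> arc_mean_osc f a b < \<epsilon>}"

definition cayley :: "complex \<Rightarrow> complex" where
  "cayley z = (z - \<i>) / (z + \<i>)"

end

theory Submission
  imports Defs
begin

text \<open>
  Parametrize the circle by the angle. With \<open>F t = f (cis t)\<close>, a function of period \<open>2 * pi\<close>, and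
  \<open>angle x = pi + 2 * arctan x\<close>, the Cayley transform sends the real number \<open>x\<close> to \<open>cis (angle x)\<close>,
  so the theorem compares the mean oscillations of \<open>F\<close> with those of its composition with \<open>angle\<close>.

  Both implications rest on the conformal invariance of BMO: the BMO seminorms of \<open>F\<close> on the
  circle and of \<open>F \<circ> angle\<close> on the line bound each other up to absolute factors. Substituting in the
  integral over an interval does not give this, because the density of \<open>angle\<close> varies by an unbounded factor on a long
  interval. Sharp cut-offs are therefore replaced by the Cauchy kernel on the line and the Poisson
  kernel on the circle, which the Cayley transform turns into each other exactly
  (\<open>cauchy_kernel_eq_poisson_kernel\<close>). On an interval the kernel of that width dominates the normalized
  indicator function up to a factor; conversely a BMO function, minus its mean over a central interval, has a bounded
  integral against the kernel, because means over concentric intervals drift only linearly in the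
  number of doublings while the kernel decays geometrically (\<open>cauchy_kernel_bound\<close>). Going from an
  interval to the kernel, through the Cayley transform, and from the kernel back to BMO gives
  \<open>mean_osc_comp_angle_le\<close> and \<open>mean_osc_arc_le\<close>.

  The rest is approximation by continuous functions. If \<open>f\<close> is in VMO, averaging \<open>F\<close> over a short
  window gives a continuous periodic function that is close to \<open>F\<close> in the BMO seminorm
  (\<open>mean_osc_diff_steklov_mean_le\<close>); pulled back to the line, it has the same limit at both ends, so
  up to a constant it is uniformly close to a function with compact support. If \<open>F \<circ> angle\<close> is in CMO, a
  nearby function with compact support extends continuously to the circle by the value 0 at the point
  1, and a BMO limit of functions continuous on the circle has small oscillation on short arcs.
\<close>

section \<open>Mean oscillation on an interval\<close>

lemma locally_integrable_iff:
  "locally_integrable f \<longleftrightarrow> (\<forall>a b. f absolutely_integrable_on {a..b})"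
proof
  assume *: "\<forall>a b. f absolutely_integrable_on {a..b}"
  show "locally_integrable f"
    unfolding locally_integrable_def
  proof (intro allI impI)
    fix K :: "real set" assume K: "compact K"
    then obtain a where "K \<subseteq> cbox (-a) a"
      using bounded_subset_cbox_symmetric compact_imp_bounded by blast
    moreover have "K \<in> sets lebesgue"
      using K by (simp add: compact_imp_closed borel_closed)
    ultimately show "f absolutely_integrable_on K"
      using set_integrable_subset[OF *[rule_format, of "-a" a], of K] by simp
  qed
qed (simp add: locally_integrable_def)

lemma locally_integrableD: "locally_integrable f \<Longrightarrow> f absolutely_integrable_on {a..b}"
  by (simp add: locally_integrable_iff)

lemma locally_integrable_diff:
  "locally_integrable f \<Longrightarrow> locally_integrable g \<Longrightarrow> locally_integrable (\<lambda>x. f x - g x)"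
  by (auto simp: locally_integrable_iff)

lemma locally_integrable_continuous:
  "continuous_on UNIV f \<Longrightarrow> locally_integrable f"
  unfolding locally_integrable_iff
  using absolutely_integrable_continuous_real continuous_on_subset by blast

lemma absolutely_integrable_dist:
  fixes f :: "real \<Rightarrow> complex"
  assumes "f absolutely_integrable_on {a..b}"
  shows "(\<lambda>x. norm (f x - c)) absolutely_integrable_on {a..b}"
  using assms by (intro absolutely_integrable_norm[unfolded o_def] set_integral_diff) auto

lemma integrable_dist:
  fixes f :: "real \<Rightarrow> complex"
  assumes "f absolutely_integrable_on {a..b}"
  shows "(\<lambda>x. norm (f x - c)) integrable_on {a..b}"
  using absolutely_integrable_dist[OF assms] by (rule set_lebesgue_integral_eq_integral)

lemma interval_mean_eq:
  assumes "f absolutely_integrable_on {a..b}"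
  shows "interval_mean f a b = (1 / (b - a)) *\<^sub>R integral {a..b} f"
  using assms by (simp add: interval_mean_def set_lebesgue_integral_eq_integral)

lemma integral_dist_mean:
  assumes "f absolutely_integrable_on {a..b}" "a < b"
  shows "integral {a..b} (\<lambda>x. norm (f x - interval_mean f a b)) = (b - a) * mean_osc f a b"
  using assms absolutely_integrable_dist[OF assms(1)]
  by (simp add: mean_osc_def set_lebesgue_integral_eq_integral)

lemma mean_osc_nonneg: "a < b \<Longrightarrow> 0 \<le> mean_osc f a b"
  unfolding mean_osc_def set_lebesgue_integral_def by simp

lemma dist_interval_mean_le:
  assumes f: "f absolutely_integrable_on {a..b}" and ab: "a < b"
  shows "(b - a) * norm (interval_mean f a b - c) \<le> integral {a..b} (\<lambda>x. norm (f x - c))"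
proof -
  have fi: "f integrable_on {a..b}" using f by (rule set_lebesgue_integral_eq_integral)
  have "(b - a) * norm (interval_mean f a b - c) = norm ((b - a) *\<^sub>R (interval_mean f a b - c))"
    using ab by simp
  also have "(b - a) *\<^sub>R (interval_mean f a b - c) = integral {a..b} (\<lambda>x. f x - c)"
    using ab fi by (subst integral_diff) (auto simp: interval_mean_eq[OF f] scaleR_diff_right)
  also have "norm \<dots> \<le> integral {a..b} (\<lambda>x. norm (f x - c))"
    by (rule integral_norm_bound_integral) (use fi integrable_dist[OF f] in \<open>auto intro: integrable_diff\<close>)
  finally show ?thesis .
qed

text \<open>The mean minimizes the averaged distance up to a factor 2. All later bounds on oscillations are
obtained by exhibiting one good constant, which need not be the mean.\<close>

lemma mean_osc_le_dist_const:
  assumes f: "f absolutely_integrable_on {a..b}" and ab: "a < b"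
  shows "(b - a) * mean_osc f a b \<le> 2 * integral {a..b} (\<lambda>x. norm (f x - c))"
proof -
  let ?m = "interval_mean f a b"
  have "(b - a) * mean_osc f a b = integral {a..b} (\<lambda>x. norm (f x - ?m))"
    using integral_dist_mean[OF f ab] by simp
  also have "\<dots> \<le> integral {a..b} (\<lambda>x. norm (f x - c) + norm (?m - c))"
    by (rule integral_le)
       (use integrable_dist[OF f] norm_triangle_ineq4[of "f _ - c" "?m - c"] in \<open>auto intro!: integrable_add\<close>)
  also have "\<dots> = integral {a..b} (\<lambda>x. norm (f x - c)) + (b - a) * norm (?m - c)"
    using ab integrable_dist[OF f] by (subst integral_add) auto
  finally show ?thesis using dist_interval_mean_le[OF f ab, of c] by simp
qed

lemma mean_osc_le_of_dist_const:
  assumes "f absolutely_integrable_on {a..b}" "a < b"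
    and "integral {a..b} (\<lambda>x. norm (f x - c)) \<le> C * (b - a)"
  shows "mean_osc f a b \<le> 2 * C"
proof -
  have "(b - a) * mean_osc f a b \<le> (b - a) * (2 * C)"
    using mean_osc_le_dist_const[OF assms(1,2), of c] assms(3) by (simp add: algebra_simps)
  then show ?thesis using assms(2) by simp
qed

lemma mean_osc_le_sup_dist:
  assumes "f absolutely_integrable_on {a..b}" "a < b" "\<And>x. x \<in> {a..b} \<Longrightarrow> norm (f x - c) \<le> C"
  shows "mean_osc f a b \<le> 2 * C"
proof (rule mean_osc_le_of_dist_const)
  have "integral {a..b} (\<lambda>x. norm (f x - c)) \<le> integral {a..b} (\<lambda>x. C)"
    by (rule integral_le) (use assms integrable_dist[OF assms(1)] in auto)
  then show "integral {a..b} (\<lambda>x. norm (f x - c)) \<le> C * (b - a)"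
    using assms(2) by (simp add: mult.commute)
qed fact+

lemma mean_osc_add_le:
  assumes f: "f absolutely_integrable_on {a..b}" and g: "g absolutely_integrable_on {a..b}"
    and ab: "a < b"
  shows "mean_osc (\<lambda>x. f x + g x) a b \<le> mean_osc f a b + mean_osc g a b"
proof -
  let ?m = "interval_mean f a b" let ?n = "interval_mean g a b"
  have fg: "(\<lambda>x. f x + g x) absolutely_integrable_on {a..b}" using f g by auto
  have m: "interval_mean (\<lambda>x. f x + g x) a b = ?m + ?n"
    using f g by (simp add: interval_mean_def set_integral_add scaleR_add_right)
  have "(b - a) * mean_osc (\<lambda>x. f x + g x) a b = integral {a..b} (\<lambda>x. norm ((f x + g x) - (?m + ?n)))"
    using integral_dist_mean[OF fg ab] m by simp
  also have "\<dots> \<le> integral {a..b} (\<lambda>x. norm (f x - ?m) + norm (g x - ?n))"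
  proof (rule integral_le)
    show "norm (f x + g x - (?m + ?n)) \<le> norm (f x - ?m) + norm (g x - ?n)" for x
      using norm_triangle_ineq[of "f x - ?m" "g x - ?n"] by (simp add: algebra_simps)
  qed (use integrable_dist[OF f] integrable_dist[OF g] integrable_dist[OF fg] in \<open>auto intro!: integrable_add\<close>)
  also have "\<dots> = (b - a) * (mean_osc f a b + mean_osc g a b)"
    using integrable_dist[OF f] integrable_dist[OF g] integral_dist_mean[OF f ab] integral_dist_mean[OF g ab]
    by (subst integral_add) (auto simp: algebra_simps)
  finally show ?thesis using ab by simp
qed

lemma mean_osc_add_const:
  assumes f: "f absolutely_integrable_on {a..b}" and ab: "a < b"
  shows "mean_osc (\<lambda>x. f x + c) a b = mean_osc f a b"
proof -
  have "interval_mean (\<lambda>x. f x + c) a b = interval_mean f a b + c"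
  proof -
    have c: "(\<lambda>x. c) absolutely_integrable_on {a..b}" by simp
    show ?thesis
      unfolding interval_mean_def using f c ab
      by (simp add: set_integral_add scaleR_add_right set_lebesgue_integral_eq_integral)
  qed
  then show ?thesis by (simp add: mean_osc_def)
qed

text \<open>Fewer than \<open>(b - a) / \<eta> + 1 \<le> 2 * (b - a) / \<eta>\<close> intervals of length \<open>\<eta>\<close> cover \<open>{a..b}\<close>. The lemma
carries bounds from one length scale to all larger ones, both for periodic functions, where \<open>\<eta>\<close> is
the period, and for averages over a short window.\<close>

lemma integral_le_of_unit_intervals:
  fixes g :: "real \<Rightarrow> real"
  assumes int: "\<And>a b. g integrable_on {a..b}" and nonneg: "\<And>x. 0 \<le> g x"
    and \<eta>: "\<eta> > 0" "\<eta> \<le> b - a"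
    and le: "\<And>p. integral {p..p + \<eta>} g \<le> C * \<eta>"
  shows "integral {a..b} g \<le> 2 * C * (b - a)"
proof -
  have steps: "integral {a..a + real n * \<eta>} g \<le> C * (real n * \<eta>)" for n
  proof (induction n)
    case (Suc n)
    have "integral {a..a + real (Suc n) * \<eta>} g
      = integral {a..a + real n * \<eta>} g + integral {a + real n * \<eta>..(a + real n * \<eta>) + \<eta>} g"
      using \<eta>(1) Henstock_Kurzweil_Integration.integral_combine[of a "a + real n * \<eta>" "a + real (Suc n) * \<eta>" g] int
      by (simp add: algebra_simps)
    then show ?case using Suc le[of "a + real n * \<eta>"] by (simp add: algebra_simps)
  qed simp
  have "0 \<le> integral {a..a + \<eta>} g" using nonneg by (intro integral_nonneg int) auto
  then have "0 \<le> C" using le[of a] \<eta>(1) by (smt (verit) zero_le_mult_iff)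
  define n where "n = nat \<lceil>(b - a) / \<eta>\<rceil>"
  have "(b - a) / \<eta> \<le> real n" "real n \<le> (b - a) / \<eta> + 1"
    using \<eta> unfolding n_def by (auto intro: real_nat_ceiling_ge simp: of_int_ceiling_le_add_one)
  then have n: "b - a \<le> real n * \<eta>" "real n * \<eta> \<le> b - a + \<eta>"
    using \<eta> by (auto simp: field_simps)
  have "integral {a..b} g \<le> integral {a..a + real n * \<eta>} g"
    using n nonneg by (intro integral_subset_le int) auto
  also have "\<dots> \<le> C * (real n * \<eta>)" by (rule steps)
  also have "\<dots> \<le> C * (2 * (b - a))" using n \<eta> \<open>0 \<le> C\<close> by (intro mult_left_mono) auto
  finally show ?thesis by (simp add: algebra_simps)
qed

section \<open>Integrals of BMO functions against the Cauchy kernel\<close>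

text \<open>This is \<open>pi\<close> times the Poisson kernel of the upper half plane at the point \<open>x\<^sub>0 + \<i> y\<close>.\<close>

definition cauchy_kernel :: "real \<Rightarrow> real \<Rightarrow> real \<Rightarrow> real" where
  "cauchy_kernel x\<^sub>0 y x = y / ((x - x\<^sub>0)\<^sup>2 + y\<^sup>2)"

lemma locally_integrable_imp_measurable:
  assumes "locally_integrable f"
  shows "f \<in> borel_measurable lebesgue"
proof (rule borel_measurable_LIMSEQ_metric)
  show "(\<lambda>x. indicator {- real n..real n} x *\<^sub>R f x) \<in> borel_measurable lebesgue" for n
    using locally_integrableD[OF assms, of "- real n" "real n"]
    by (simp add: set_integrable_def borel_measurable_integrable)
  show "(\<lambda>n. indicator {- real n..real n} x *\<^sub>R f x) \<longlonglongrightarrow> f x" for x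
  proof (rule tendsto_eventually)
    obtain N :: nat where N: "\<bar>x\<bar> \<le> real N" using real_arch_simple by blast
    show "\<forall>\<^sub>F n in sequentially. indicator {- real n..real n} x *\<^sub>R f x = f x"
      using eventually_ge_at_top[of N]
    proof eventually_elim
      case (elim n)
      then have "x \<in> {- real n..real n}" using N by (auto simp: abs_le_iff)
      then show ?case by simp
    qed
  qed
qed

text \<open>Doubling an interval moves the mean by at most twice the oscillation over the larger interval, so
\<open>k\<close> doublings move it by an amount linear in \<open>k\<close>.\<close>

lemma dist_dyadic_means_le:
  assumes f: "locally_integrable f" and B: "\<And>a b. a < b \<Longrightarrow> mean_osc f a b \<le> B" and y: "y > 0"
  shows "norm (interval_mean f (x\<^sub>0 - 2^k * y) (x\<^sub>0 + 2^k * y) - interval_mean f (x\<^sub>0 - y) (x\<^sub>0 + y))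
         \<le> 2 * real k * B"
proof (induction k)
  case (Suc k)
  define r where "r = 2^k * y"
  have r: "r > 0" using y by (simp add: r_def)
  define m where "m s = interval_mean f (x\<^sub>0 - s) (x\<^sub>0 + s)" for s
  have fi: "f absolutely_integrable_on {a..b}" for a b using f by (rule locally_integrableD)
  have "2 * r * norm (m r - m (2 * r)) \<le> integral {x\<^sub>0 - r..x\<^sub>0 + r} (\<lambda>x. norm (f x - m (2 * r)))"
    using dist_interval_mean_le[OF fi, of "x\<^sub>0 - r" "x\<^sub>0 + r"] r by (simp add: m_def)
  also have "\<dots> \<le> integral {x\<^sub>0 - 2 * r..x\<^sub>0 + 2 * r} (\<lambda>x. norm (f x - m (2 * r)))"
    using r integrable_dist[OF fi] by (intro integral_subset_le) auto
  also have "\<dots> = 4 * r * mean_osc f (x\<^sub>0 - 2 * r) (x\<^sub>0 + 2 * r)"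
    using integral_dist_mean[OF fi, of "x\<^sub>0 - 2 * r" "x\<^sub>0 + 2 * r"] r by (simp add: m_def)
  also have "\<dots> \<le> 4 * r * B" using B r by (intro mult_left_mono) auto
  finally have "norm (m r - m (2 * r)) \<le> 2 * B" using r by simp
  moreover have "norm (m r - m y) \<le> 2 * real k * B" using Suc by (simp add: m_def r_def)
  ultimately have "norm (m (2 * r) - m y) \<le> 2 * real (Suc k) * B"
    using norm_triangle_ineq4[of "m r - m y" "m r - m (2 * r)"] by (simp add: algebra_simps)
  then show ?case by (simp add: m_def r_def mult.assoc)
qed simp

text \<open>If \<open>k\<close> is the first exponent with \<open>\<bar>x - x\<^sub>0\<bar> \<le> 2^k * y\<close>, then \<open>\<bar>x - x\<^sub>0\<bar>\<close> is larger than
\<open>2^k * y / 2\<close> unless \<open>k = 0\<close>, and the kernel has decayed accordingly.\<close>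

lemma cauchy_kernel_le_dyadic:
  assumes y: "y > 0"
  obtains k where "\<bar>x - x\<^sub>0\<bar> \<le> 2^k * y" "cauchy_kernel x\<^sub>0 y x \<le> 4 / (4^k * y)"
proof -
  obtain n :: nat where "\<bar>x - x\<^sub>0\<bar> / y < 2^n" using real_arch_pow[of 2] by auto
  then have ex: "\<exists>n. \<bar>x - x\<^sub>0\<bar> \<le> 2^n * y" using y by (intro exI[of _ n]) (simp add: field_simps)
  define k where "k = (LEAST n. \<bar>x - x\<^sub>0\<bar> \<le> 2^n * y)"
  have k: "\<bar>x - x\<^sub>0\<bar> \<le> 2^k * y" unfolding k_def by (rule LeastI_ex[OF ex])
  have "4^k * y\<^sup>2 \<le> 4 * ((x - x\<^sub>0)\<^sup>2 + y\<^sup>2)"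
  proof (cases k)
    case (Suc j)
    then have "2^j * y < \<bar>x - x\<^sub>0\<bar>" using not_less_Least[of j "\<lambda>n. \<bar>x - x\<^sub>0\<bar> \<le> 2^n * y"]
      by (simp add: k_def)
    then have "(2^j * y)\<^sup>2 \<le> \<bar>x - x\<^sub>0\<bar>\<^sup>2" using y by (intro power_mono) auto
    moreover have "((2::real)^j)\<^sup>2 = 4^j" by (simp add: power_mult[symmetric] power_mult_distrib[symmetric] mult.commute power2_eq_square)
    ultimately have "4^j * y\<^sup>2 \<le> (x - x\<^sub>0)\<^sup>2" by (simp add: power_mult_distrib)
    also have "\<dots> \<le> (x - x\<^sub>0)\<^sup>2 + y\<^sup>2" by simp
    finally have "4 * (4^j * y\<^sup>2) \<le> 4 * ((x - x\<^sub>0)\<^sup>2 + y\<^sup>2)" by (rule mult_left_mono) simp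
    then show ?thesis using Suc by (simp add: mult.assoc)
  qed (simp)
  moreover have "(x - x\<^sub>0)\<^sup>2 + y\<^sup>2 > 0" using y by (simp add: add_nonneg_pos)
  ultimately have "cauchy_kernel x\<^sub>0 y x \<le> 4 / (4^k * y)"
    using y unfolding cauchy_kernel_def by (simp add: field_simps power2_eq_square)
  then show ?thesis using that k by blast
qed

lemma cauchy_kernel_pos: "y > 0 \<Longrightarrow> cauchy_kernel x\<^sub>0 y x > 0"
  unfolding cauchy_kernel_def by (simp add: add_nonneg_pos)

lemma cauchy_kernel_nonneg: "y > 0 \<Longrightarrow> 0 \<le> cauchy_kernel x\<^sub>0 y x"
  using cauchy_kernel_pos less_imp_le by blast

text \<open>The general term is the product of the kernel bound \<open>4 / (4^k * y)\<close> on the \<open>k\<close>-th dyadic interval,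
the length \<open>2 * 2^k * y\<close> of that interval, and the drift \<open>1 + 2 * k\<close> of the means.\<close>

lemma sums_dyadic_weights: "(\<lambda>k. 8 * (1 + 2 * real k) / 2^k) sums 48"
proof -
  have 1: "(\<lambda>k. (1/2::real)^k) sums 2" using geometric_sums[of "1/2::real"] by simp
  have 2: "(\<lambda>k. real (Suc k) * (1/2)^k) sums 4"
    using geometric_deriv_sums[of "1/2::real"] by (simp add: power2_eq_square)
  have "(\<lambda>k. 16 * (real (Suc k) * (1/2)^k) - 8 * (1/2)^k) sums (16 * 4 - 8 * 2)"
    by (intro sums_diff sums_mult 1 2)
  moreover have "16 * (real (Suc k) * (1/2)^k) - 8 * (1/2)^k = 8 * (1 + 2 * real k) / 2^k" for k
    by (simp add: field_simps)
  ultimately show ?thesis by simp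
qed

text \<open>The kernel is dominated by a sum of multiples of indicator functions of the dyadic intervals around
\<open>x\<^sub>0\<close>. On the \<open>k\<close>-th interval \<open>f - c\<close> consists of the deviation from the mean over that interval, which
contributes \<open>B\<close>, and of the drift of the means, which contributes \<open>2 * k * B\<close>; the resulting series
converges.\<close>

lemma cauchy_kernel_bound:
  fixes x\<^sub>0 y :: real
  assumes f: "locally_integrable f" and B: "\<And>a b. a < b \<Longrightarrow> mean_osc f a b \<le> B" and y: "y > 0"
  defines "c \<equiv> interval_mean f (x\<^sub>0 - y) (x\<^sub>0 + y)"
  shows "(\<lambda>x. norm (f x - c) * cauchy_kernel x\<^sub>0 y x) absolutely_integrable_on UNIV"
    and "integral UNIV (\<lambda>x. norm (f x - c) * cauchy_kernel x\<^sub>0 y x) \<le> 48 * B"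
proof -
  let ?g = "\<lambda>x. norm (f x - c) * cauchy_kernel x\<^sub>0 y x"
  define I where "I k = {x\<^sub>0 - 2^k * y..x\<^sub>0 + 2^k * y}" for k :: nat
  define w where "w k = 4 / (4^k * y)" for k :: nat
  define T where "T k x = w k * (indicator (I k) x * norm (f x - c))" for k x
  have fi: "f absolutely_integrable_on {a..b}" for a b using f by (rule locally_integrableD)
  have wpos: "w k \<ge> 0" for k using y by (simp add: w_def)
  have [measurable]: "f \<in> borel_measurable lebesgue"
    using f by (rule locally_integrable_imp_measurable)
  have I_int: "integral (I k) (\<lambda>x. norm (f x - c)) \<le> 2 * 2^k * y * ((1 + 2 * real k) * B)" for k
  proof -
    let ?m = "interval_mean f (x\<^sub>0 - 2^k * y) (x\<^sub>0 + 2^k * y)"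
    have lt: "x\<^sub>0 - 2^k * y < x\<^sub>0 + 2^k * y" using y by (simp add: add_pos_pos)
    have "integral (I k) (\<lambda>x. norm (f x - c)) \<le> integral (I k) (\<lambda>x. norm (f x - ?m) + norm (?m - c))"
      unfolding I_def
      by (rule integral_le)
         (use integrable_dist[OF fi] norm_triangle_ineq[of "f _ - ?m" "?m - c"] in \<open>auto intro!: integrable_add\<close>)
    also have "\<dots> = integral (I k) (\<lambda>x. norm (f x - ?m)) + 2 * 2^k * y * norm (?m - c)"
      using lt integrable_dist[OF fi] unfolding I_def by (subst integral_add) auto
    also have "integral (I k) (\<lambda>x. norm (f x - ?m)) = 2 * 2^k * y * mean_osc f (x\<^sub>0 - 2^k * y) (x\<^sub>0 + 2^k * y)"
      using integral_dist_mean[OF fi lt] unfolding I_def by simp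
    also have "2 * 2^k * y * mean_osc f (x\<^sub>0 - 2^k * y) (x\<^sub>0 + 2^k * y) + 2 * 2^k * y * norm (?m - c)
       \<le> 2 * 2^k * y * B + 2 * 2^k * y * (2 * real k * B)"
      using y B[OF lt] dist_dyadic_means_le[OF f B y, of x\<^sub>0 k] unfolding c_def
      by (intro add_mono mult_left_mono) auto
    finally show ?thesis by (simp add: algebra_simps)
  qed
  have T_int: "integrable lebesgue (T k)" for k
    using absolutely_integrable_dist[OF fi, of "x\<^sub>0 - 2^k * y" "x\<^sub>0 + 2^k * y" c]
    unfolding T_def I_def set_integrable_def by simp
  have T_le: "(\<integral>\<^sup>+x. ennreal (T k x) \<partial>lebesgue) \<le> ennreal (8 * (1 + 2 * real k) / 2^k * B)" for k
  proof -
    have "(\<integral>\<^sup>+x. ennreal (T k x) \<partial>lebesgue) = ennreal (integral\<^sup>L lebesgue (T k))"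
      by (intro nn_integral_eq_integral T_int AE_I2) (simp add: T_def wpos)
    also have "integral\<^sup>L lebesgue (T k) = w k * (LINT x:I k|lebesgue. norm (f x - c))"
      unfolding T_def set_lebesgue_integral_def by simp
    also have "\<dots> = w k * integral (I k) (\<lambda>x. norm (f x - c))"
      using absolutely_integrable_dist[OF fi] unfolding I_def by (simp add: set_lebesgue_integral_eq_integral)
    also have "\<dots> \<le> w k * (2 * 2^k * y * ((1 + 2 * real k) * B))"
      by (intro mult_left_mono I_int wpos)
    also have "\<dots> = 8 * (1 + 2 * real k) / 2^k * B"
    proof -
      have "(4::real)^k = 2^k * 2^k" by (simp add: power_mult_distrib[symmetric])
      then show ?thesis using y unfolding w_def by (simp add: field_simps)
    qed
    finally show ?thesis using ennreal_leI by blast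
  qed
  have B0: "0 \<le> B" using mean_osc_nonneg[of 0 1 f] B[of 0 1] by simp
  \<comment> \<open>Nonnegative integrals give integrability of the product and the bound at the same time.\<close>
  have "(\<integral>\<^sup>+x. ennreal (norm (?g x)) \<partial>lebesgue) \<le> (\<integral>\<^sup>+x. (\<Sum>k. ennreal (T k x)) \<partial>lebesgue)"
  proof (rule nn_integral_mono)
    fix x
    obtain k where k: "\<bar>x - x\<^sub>0\<bar> \<le> 2^k * y" "cauchy_kernel x\<^sub>0 y x \<le> w k"
      using cauchy_kernel_le_dyadic[OF y] unfolding w_def by metis
    then have "x \<in> I k" by (auto simp: I_def abs_le_iff algebra_simps)
    then have "norm (?g x) \<le> T k x"
      using k(2) cauchy_kernel_pos[OF y, of x\<^sub>0 x] unfolding T_def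
      by (simp add: abs_mult mult.commute mult_right_mono)
    then have "ennreal (norm (?g x)) \<le> ennreal (T k x)" by (rule ennreal_leI)
    also have "\<dots> \<le> (\<Sum>k. ennreal (T k x))"
      using sum_le_suminf[of "\<lambda>k. ennreal (T k x)" "{k}"] by simp
    finally show "ennreal (norm (?g x)) \<le> (\<Sum>k. ennreal (T k x))" .
  qed
  also have "\<dots> = (\<Sum>k. \<integral>\<^sup>+x. ennreal (T k x) \<partial>lebesgue)"
    using T_int by (intro nn_integral_suminf) (auto intro: borel_measurable_integrable)
  also have "\<dots> \<le> (\<Sum>k. ennreal (8 * (1 + 2 * real k) / 2^k * B))"
    by (intro suminf_le T_le) auto
  also have "\<dots> = ennreal (48 * B)"
    using B0 by (intro suminf_ennreal_eq sums_mult2 sums_dyadic_weights) auto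
  finally have bound: "(\<integral>\<^sup>+x. ennreal (norm (?g x)) \<partial>lebesgue) \<le> ennreal (48 * B)" .
  have ck: "cauchy_kernel x\<^sub>0 y \<in> borel_measurable lebesgue"
    unfolding cauchy_kernel_def
    by (rule measurable_completion) measurable
  have int: "integrable lebesgue ?g"
    using bound ck by (intro integrableI_bounded) (auto simp: top.not_eq_extremum intro: le_less_trans)
  then show "?g absolutely_integrable_on UNIV" by (simp add: set_integrable_def)
  then have "integral UNIV ?g = integral\<^sup>L lebesgue ?g"
    using set_lebesgue_integral_eq_integral(2)[of UNIV ?g] by (simp add: set_lebesgue_integral_def)
  also have "ennreal \<dots> = (\<integral>\<^sup>+x. ennreal (?g x) \<partial>lebesgue)"
    by (intro nn_integral_eq_integral[symmetric] int AE_I2)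
       (simp add: less_imp_le[OF cauchy_kernel_pos[OF y]])
  also have "\<dots> \<le> (\<integral>\<^sup>+x. ennreal (norm (?g x)) \<partial>lebesgue)"
    by (intro nn_integral_mono ennreal_leI) simp
  also note bound
  finally show "integral UNIV ?g \<le> 48 * B" using B0 by simp
qed

section \<open>Periodic functions\<close>

lemma periodic_int_multiple:
  fixes g :: "real \<Rightarrow> 'a" and p :: real
  assumes "\<And>t. g (t + p) = g t"
  shows "g (t + of_int n * p) = g t"
proof -
  have nat: "g (t + real k * p) = g t" for k t
  proof (induction k)
    case (Suc k)
    have "t + real (Suc k) * p = (t + real k * p) + p" by (simp add: algebra_simps)
    then show ?case using assms[of "t + real k * p"] Suc by (simp only:)
  qed simp
  show ?thesis
  proof (cases "n \<ge> 0")
    case True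
    then show ?thesis using nat[of t "nat n"] by simp
  next
    case False
    then show ?thesis using nat[of "t + of_int n * p" "nat (- n)"] by (simp add: algebra_simps)
  qed
qed

lemma absolutely_integrable_shift_Icc_real:
  fixes f :: "real \<Rightarrow> 'a::euclidean_space"
  shows "(\<lambda>x. f (x + c)) absolutely_integrable_on {a..b} \<longleftrightarrow> f absolutely_integrable_on {a + c..b + c}"
  unfolding absolutely_integrable_on_def integrable_on_def
  using has_integral_shift_Icc_real[of f c _ a b] has_integral_shift_Icc_real[of "\<lambda>x. norm (f x)" c _ a b]
  by (simp add: o_def add.commute)

lemma periodic_absolutely_integrable:
  fixes g :: "real \<Rightarrow> 'a::euclidean_space" and p :: real
  assumes per: "\<And>t. g (t + p) = g t" and p: "p > 0" and int: "g absolutely_integrable_on {0..p}"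
  shows "g absolutely_integrable_on {a..b}"
proof -
  have sym: "g absolutely_integrable_on {- (real n * p)..real n * p}" for n
  proof (induction n)
    case (Suc n)
    have one: "g absolutely_integrable_on {of_int m * p..of_int (m + 1) * p}" for m
    proof -
      have "(\<lambda>x. g (x + of_int m * p)) = g"
        by (rule ext) (rule periodic_int_multiple[of g p, OF per])
      then show ?thesis
        using absolutely_integrable_shift_Icc_real[where f = g and c = "of_int m * p" and a = 0 and b = p] int
        by (simp add: distrib_right add.commute)
    qed
    have "of_int (- int (Suc n)) * p = - (real (Suc n) * p)"
      "of_int (- int (Suc n) + 1) * p = - (real n * p)" by (simp_all add: algebra_simps)
    then have "g absolutely_integrable_on {- (real (Suc n) * p)..- (real n * p)}"
      using one[of "- int (Suc n)"] by (simp only:)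
    moreover have "of_int (int n) * p = real n * p"
      "of_int (int n + 1) * p = real (Suc n) * p" by simp_all
    then have "g absolutely_integrable_on {real n * p..real (Suc n) * p}"
      using one[of "int n"] by (simp only:)
    ultimately have "g absolutely_integrable_on ({- (real (Suc n) * p)..- (real n * p)}
        \<union> {- (real n * p)..real n * p} \<union> {real n * p..real (Suc n) * p})"
      using Suc by (intro absolutely_integrable_Un) auto
    moreover have "{- (real (Suc n) * p)..- (real n * p)} \<union> {- (real n * p)..real n * p}
      \<union> {real n * p..real (Suc n) * p} = {- (real (Suc n) * p)..real (Suc n) * p}"
    proof -
      have "{- (q + p)..- q} \<union> {- q..q} \<union> {q..q + p} = {- (q + p)..q + p}" if "0 \<le> q" for q
        using that p by auto
      from this[of "real n * p"] show ?thesis using p by (simp add: algebra_simps)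
    qed
    ultimately show ?case by simp
  qed (simp add: absolutely_integrable_negligible)
  obtain n :: nat where n: "max \<bar>a\<bar> \<bar>b\<bar> / p \<le> real n" using real_arch_simple by blast
  then have "max \<bar>a\<bar> \<bar>b\<bar> \<le> real n * p" using p by (simp add: field_simps)
  then have "{a..b} \<subseteq> {- (real n * p)..real n * p}" by auto
  then show ?thesis using sym by (rule absolutely_integrable_on_subinterval[rotated])
qed

lemma periodic_integral_eq:
  fixes g :: "real \<Rightarrow> 'a::euclidean_space" and p :: real
  assumes per: "\<And>t. g (t + p) = g t" and p: "p > 0" and int: "\<And>a b. g integrable_on {a..b}"
  shows "integral {a..a + p} g = integral {0..p} g"
proof -
  define m where "m = \<lfloor>a / p\<rfloor>"
  define q where "q = of_int m * p"
  have "of_int m \<le> a / p" "a / p \<le> of_int m + 1" by (simp_all add: m_def)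
  then have q: "q \<le> a" "a \<le> q + p" using p by (auto simp: q_def field_simps)
  have "integral {a..a + p} g = integral {a..q + p} g + integral {q + p..a + p} g"
    using q int by (intro Henstock_Kurzweil_Integration.integral_combine[symmetric]) auto
  also have "integral {q + p..a + p} g = integral {q..a} g"
    using integral_shift_Icc_real[of q a g p] per by (simp add: o_def add.commute[of p])
  also have "integral {a..q + p} g + integral {q..a} g = integral {q..q + p} g"
    using q int Henstock_Kurzweil_Integration.integral_combine[of q a "q + p" g]
    by (simp add: add.commute)
  also have "\<dots> = integral {0..p} g"
  proof -
    have "(\<lambda>x. g (q + x)) = g"
      unfolding q_def by (subst add.commute) (rule ext, rule periodic_int_multiple[of g p, OF per])
    then show ?thesis using integral_shift_Icc_real[of 0 p g q] by (simp add: o_def add.commute)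
  qed
  finally show ?thesis .
qed

text \<open>On an interval longer than a period, compare with the mean over one period: the interval is covered
by periods, and each contributes the same integral.\<close>

lemma mean_osc_periodic_le:
  assumes per: "\<And>t. F (t + p) = F t" and p: "p > 0" and F: "locally_integrable F"
    and B: "\<And>a b. a < b \<Longrightarrow> b \<le> a + p \<Longrightarrow> mean_osc F a b \<le> B"
    and ab: "a < b"
  shows "mean_osc F a b \<le> 4 * B"
proof (cases "b \<le> a + p")
  case True
  then show ?thesis using B[OF ab] mean_osc_nonneg[OF ab, of F] by simp
next
  case False
  define c where "c = interval_mean F 0 p"
  have Fi: "F absolutely_integrable_on {a..b}" for a b using F by (rule locally_integrableD)
  have "integral {q..q + p} (\<lambda>x. norm (F x - c)) \<le> B * p" for q
  proof -
    have "integral {q..q + p} (\<lambda>x. norm (F x - c)) = integral {0..p} (\<lambda>x. norm (F x - c))"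
      by (rule periodic_integral_eq) (use per p integrable_dist[OF Fi] in auto)
    also have "\<dots> = p * mean_osc F 0 p" using integral_dist_mean[OF Fi p] by (simp add: c_def)
    also have "\<dots> \<le> B * p" using B[of 0 p] p by (simp add: mult.commute)
    finally show ?thesis .
  qed
  then have "integral {a..b} (\<lambda>x. norm (F x - c)) \<le> 2 * B * (b - a)"
    using False p integrable_dist[OF Fi] by (intro integral_le_of_unit_intervals[of _ p]) auto
  then show ?thesis using mean_osc_le_of_dist_const[OF Fi ab, of c "2 * B"] by simp
qed

section \<open>The Cayley transform and the two kernels\<close>

text \<open>The angle, strictly between 0 and \<open>2 * pi\<close>, of the image of a real number under the Cayley transform.\<close>

definition angle :: "real \<Rightarrow> real" where
  "angle x = pi + 2 * arctan x"

text \<open>This is \<open>pi\<close> times the Poisson kernel of the unit disc as a density with respect to arc length, a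
normalization that makes the change of variables below free of constants.\<close>

definition poisson_kernel :: "complex \<Rightarrow> real \<Rightarrow> real" where
  "poisson_kernel w t = (1 - (norm w)\<^sup>2) / (2 * (norm (cis t - w))\<^sup>2)"

lemma real_plus_ii_neq_0: "complex_of_real x + \<i> \<noteq> 0"
  by (simp add: complex_eq_iff)

lemma cis_angle: "cis (angle x) = cayley (complex_of_real x)"
proof -
  have pos: "1 + x\<^sup>2 > 0" by (simp add: add_pos_nonneg)
  have "cis (arctan x) = (1 + \<i> * x) / sqrt (1 + x\<^sup>2)"
    by (simp add: complex_eq_iff cos_arctan sin_arctan)
  moreover have "cis (angle x) = - (cis (arctan x))\<^sup>2"
  proof -
    have "(cis (arctan x))\<^sup>2 = cis (2 * arctan x)" by (simp add: power2_eq_square cis_mult)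
    then show ?thesis by (simp add: angle_def flip: cis_mult)
  qed
  moreover have "(complex_of_real (sqrt (1 + x\<^sup>2)))\<^sup>2 = 1 + (complex_of_real x)\<^sup>2"
    using pos by (simp flip: of_real_power)
  ultimately have "cis (angle x) = - (1 + \<i> * x)\<^sup>2 / (1 + (complex_of_real x)\<^sup>2)"
    by (simp add: power_divide)
  also have "1 + (complex_of_real x)\<^sup>2 = (x - \<i>) * (x + \<i>)"
    by (simp add: power2_eq_square algebra_simps)
  also have "- (1 + \<i> * x)\<^sup>2 = (x - \<i>) * (x - \<i>)"
    by (simp add: power2_eq_square algebra_simps)
  also have "(x - \<i>) * (x - \<i>) / ((x - \<i>) * (x + \<i>)) = cayley x"
    by (simp add: cayley_def complex_eq_iff[of "complex_of_real x" \<i>])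
  finally show ?thesis .
qed

lemma one_minus_norm_cayley:
  assumes "Im z > 0"
  shows "1 - (norm (cayley z))\<^sup>2 = 4 * Im z / (norm (z + \<i>))\<^sup>2"
proof -
  have "z + \<i> \<noteq> 0" using assms by (auto simp: complex_eq_iff)
  then have "(norm (z + \<i>))\<^sup>2 \<noteq> 0" by simp
  moreover have "(norm (z + \<i>))\<^sup>2 - (norm (z - \<i>))\<^sup>2 = 4 * Im z"
    unfolding cmod_power2 by (simp add: power2_eq_square algebra_simps)
  ultimately show ?thesis
    unfolding cayley_def norm_divide power_divide
    by (metis diff_divide_distrib divide_self)
qed

lemma cayley_diff:
  assumes "z + \<i> \<noteq> 0" "w + \<i> \<noteq> 0"
  shows "cayley z - cayley w = 2 * \<i> * (z - w) / ((z + \<i>) * (w + \<i>))"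
  unfolding cayley_def using assms by (simp add: field_simps)

lemma norm_cayley_less_1: "Im z > 0 \<Longrightarrow> norm (cayley z) < 1"
proof -
  assume z: "Im z > 0"
  then have "z + \<i> \<noteq> 0" by (auto simp: complex_eq_iff)
  then have "4 * Im z / (norm (z + \<i>))\<^sup>2 > 0" using z by simp
  then have "(norm (cayley z))\<^sup>2 < 1" using one_minus_norm_cayley[OF z] by linarith
  then show ?thesis using abs_square_less_1[of "norm (cayley z)"] by simp
qed

text \<open>The kernels are the harmonic measures of the half plane and of the disc, hence correspond under the
conformal map between them; \<open>2 / (1 + x\<^sup>2)\<close> is the derivative of \<open>angle\<close>. The identity follows
from the formulas for \<open>1 - \<bar>cayley z\<bar>\<^sup>2\<close> and for differences of values of \<open>cayley\<close>.\<close>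

lemma cauchy_kernel_eq_poisson_kernel:
  assumes y: "y > 0"
  shows "cauchy_kernel x\<^sub>0 y x = 2 / (1 + x\<^sup>2) * poisson_kernel (cayley (Complex x\<^sub>0 y)) (angle x)"
proof -
  let ?z = "Complex x\<^sub>0 y"
  have z: "?z + \<i> \<noteq> 0" using y by (auto simp: complex_eq_iff)
  have n0: "(norm (?z + \<i>))\<^sup>2 > 0" using z by simp
  have xz: "(norm (complex_of_real x - ?z))\<^sup>2 = (x - x\<^sub>0)\<^sup>2 + y\<^sup>2"
    by (simp add: cmod_power2)
  have D: "(x - x\<^sub>0)\<^sup>2 + y\<^sup>2 > 0" using y by (simp add: add_nonneg_pos)
  have x1: "(norm (complex_of_real x + \<i>))\<^sup>2 = 1 + x\<^sup>2"
    by (simp add: cmod_power2)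
  have p: "1 + x\<^sup>2 > 0" by (simp add: add_pos_nonneg)
  have "(norm (cis (angle x) - cayley ?z))\<^sup>2
      = 4 * ((x - x\<^sub>0)\<^sup>2 + y\<^sup>2) / ((1 + x\<^sup>2) * (norm (?z + \<i>))\<^sup>2)"
    unfolding cis_angle cayley_diff[OF real_plus_ii_neq_0 z]
    by (simp add: norm_divide norm_mult power_divide power_mult_distrib xz x1)
  then have "poisson_kernel (cayley ?z) (angle x) =
    (4 * y / (norm (?z + \<i>))\<^sup>2) / (2 * (4 * ((x - x\<^sub>0)\<^sup>2 + y\<^sup>2) / ((1 + x\<^sup>2) * (norm (?z + \<i>))\<^sup>2)))"
    unfolding poisson_kernel_def using one_minus_norm_cayley[of ?z] y by simp
  also have "2 / (1 + x\<^sup>2) * \<dots> = y / ((x - x\<^sub>0)\<^sup>2 + y\<^sup>2)"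
  proof -
    have "2 / P * ((4 * y / N) / (2 * (4 * E / (P * N)))) = y / E"
      if "P > 0" "N > 0" "E > 0" for P N E :: real
      using that by (simp add: field_simps)
    from this[OF p n0 D] show ?thesis .
  qed
  finally show ?thesis by (simp add: cauchy_kernel_def)
qed

lemma cayley_surj_disc:
  assumes "norm w < 1"
  obtains x\<^sub>0 y where "y > 0" "cayley (Complex x\<^sub>0 y) = w"
proof -
  \<comment> \<open>The inverse of the Cayley transform.\<close>
  define z where "z = \<i> * (1 + w) / (1 - w)"
  have w1: "1 - w \<noteq> 0" using assms by auto
  have "z - \<i> = 2 * \<i> * w / (1 - w)" "z + \<i> = 2 * \<i> / (1 - w)"
    using w1 by (simp_all add: z_def field_simps)
  then have "cayley z = w" using w1 by (simp add: cayley_def)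
  moreover have "Im z > 0"
  proof -
    have "Im z = Re ((1 + w) / (1 - w))" by (simp add: z_def Re_divide Im_divide)
    also have "\<dots> = (1 - (norm w)\<^sup>2) / (norm (1 - w))\<^sup>2"
      unfolding Re_divide cmod_power2 by (simp add: power2_eq_square algebra_simps)
    also have "\<dots> > 0" using assms w1 by (simp add: abs_square_less_1)
    finally show ?thesis .
  qed
  ultimately show ?thesis using that[of "Im z" "Re z"] by simp
qed

lemma has_field_derivative_angle: "(angle has_field_derivative 2 / (1 + x\<^sup>2)) (at x within S)"
proof -
  have "1 + x\<^sup>2 \<noteq> 0" by (smt (verit) zero_le_power2)
  then show ?thesis unfolding angle_def
    by (auto intro!: derivative_eq_intros simp: field_simps)
qed

lemma strict_mono_angle: "strict_mono angle"
  by (auto simp: strict_mono_def angle_def arctan_less_iff)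

lemma continuous_on_angle: "continuous_on S angle"
  unfolding angle_def by (intro continuous_intros)

text \<open>The point 1 of the circle, at the angles 0 and \<open>2 * pi\<close>, is the only one that is missed; it
corresponds to infinity on the line.\<close>

lemma range_angle: "range angle = {0<..<2 * pi}"
proof
  show "range angle \<subseteq> {0<..<2 * pi}"
    using arctan_bounded by (auto simp: angle_def) (smt (verit) arctan_lbound arctan_ubound field_sum_of_halves)+
  show "{0<..<2 * pi} \<subseteq> range angle"
  proof
    fix t assume "t \<in> {0<..<2 * pi}"
    then have "arctan (tan ((t - pi) / 2)) = (t - pi) / 2" by (intro arctan_tan) auto
    then have "t = angle (tan ((t - pi) / 2))" by (simp add: angle_def)
    then show "t \<in> range angle" by blast
  qed
qed

lemma change_of_variables_angle:
  fixes \<phi> :: "real \<Rightarrow> real"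
  shows "(\<lambda>x. 2 / (1 + x\<^sup>2) * \<phi> (angle x)) absolutely_integrable_on UNIV \<and>
         integral UNIV (\<lambda>x. 2 / (1 + x\<^sup>2) * \<phi> (angle x)) = b
     \<longleftrightarrow> \<phi> absolutely_integrable_on {0..2 * pi} \<and> integral {0..2 * pi} \<phi> = b"
proof -
  have "\<bar>2 / (1 + x\<^sup>2)\<bar> = 2 / (1 + x\<^sup>2)" for x :: real by (simp add: abs_of_nonneg add_nonneg_nonneg)
  then show ?thesis
    using has_absolute_integral_change_of_variables_1'[of UNIV angle "\<lambda>x. 2 / (1 + x\<^sup>2)" \<phi> b,
        OF _ has_field_derivative_angle strict_mono_imp_inj_on[OF strict_mono_angle]]
    by (simp add: range_angle absolutely_integrable_on_Icc_iff_Ioo integral_open_interval_real)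
qed

lemma locally_integrable_comp_angle:
  assumes F: "locally_integrable F"
  shows "locally_integrable (\<lambda>x. F (angle x))"
  unfolding locally_integrable_iff
proof (intro allI)
  fix a b :: real
  have "angle ` {a..b} \<subseteq> {angle a..angle b}"
    using strict_mono_mono[OF strict_mono_angle] by (auto simp: mono_def)
  moreover have "compact (angle ` {a..b})"
    by (intro compact_continuous_image continuous_on_angle) auto
  ultimately have "F absolutely_integrable_on angle ` {a..b}"
    using F unfolding locally_integrable_def by blast
  then have *: "(\<lambda>x. \<bar>2 / (1 + x\<^sup>2)\<bar> *\<^sub>R F (angle x)) absolutely_integrable_on {a..b}"
    using absolutely_integrable_change_of_variables_real[of "{a..b}" angle "\<lambda>x. 2 / (1 + x\<^sup>2)" F,
        OF _ has_field_derivative_angle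
          inj_on_subset[OF strict_mono_imp_inj_on[OF strict_mono_angle] subset_UNIV]]
    by simp
  have pos: "1 + x\<^sup>2 > 0" for x :: real by (simp add: add_pos_nonneg)
  have "(\<lambda>x. ((1 + x\<^sup>2) / 2) *\<^sub>R (\<bar>2 / (1 + x\<^sup>2)\<bar> *\<^sub>R F (angle x))) absolutely_integrable_on {a..b}"
  proof (rule absolutely_integrable_bounded_measurable_product[where h = "(*\<^sub>R)", OF _ _ _ _ *])
    show "(\<lambda>x. (1 + x\<^sup>2) / 2) \<in> borel_measurable (lebesgue_on {a..b})"
      by (intro continuous_imp_measurable_on_sets_lebesgue continuous_intros) auto
    show "bounded ((\<lambda>x. (1 + x\<^sup>2) / 2) ` {a..b})"
      by (intro compact_imp_bounded compact_continuous_image continuous_intros) auto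
    show "bilinear ((*\<^sub>R) :: real \<Rightarrow> complex \<Rightarrow> complex)"
      by (simp add: bilinear_conv_bounded_bilinear bounded_bilinear_scaleR)
  qed auto
  moreover have "((1 + x\<^sup>2) / 2) *\<^sub>R (\<bar>2 / (1 + x\<^sup>2)\<bar> *\<^sub>R F (angle x)) = F (angle x)" for x
  proof -
    have "(1 + x\<^sup>2) / 2 * \<bar>2 / (1 + x\<^sup>2)\<bar> = 1" using pos[of x] by simp
    then show ?thesis by (simp only: scaleR_scaleR scaleR_one)
  qed
  ultimately show "(\<lambda>x. F (angle x)) absolutely_integrable_on {a..b}" by simp
qed

section \<open>Conformal invariance of bounded mean oscillation\<close>

text \<open>The chord is \<open>2 * sin (\<bar>\<tau>\<bar> / 2)\<close>, and \<open>sin s \<ge> s - s^3 / 6 \<ge> s / 2\<close> as long as \<open>s\<^sup>2 \<le> 3\<close>, which covers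
\<open>s \<le> pi / 2\<close>.\<close>

lemma chord_ge_half_angle:
  assumes "\<bar>\<tau>\<bar> \<le> pi"
  shows "\<bar>\<tau>\<bar> / 2 \<le> norm (cis \<tau> - 1)"
proof -
  define s where "s = \<bar>\<tau>\<bar> / 2"
  have s: "0 \<le> s" "s \<le> 8 / 5" using assms pi_less_4 pi_approx by (auto simp: s_def)
  have "\<bar>sin s - s\<bar> \<le> s^3 / 6"
    using Maclaurin_sin_bound[of s 3] s by (simp add: numeral_eq_Suc sin_coeff_def field_simps)
  moreover have "s^3 \<le> s * 3"
  proof -
    have "s * s \<le> 8 / 5 * (8 / 5)" using s by (intro mult_mono) auto
    then have "s * (s * s) \<le> s * 3" using s by (intro mult_left_mono) auto
    then show ?thesis by (simp add: power3_eq_cube)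
  qed
  ultimately have "s \<le> 2 * sin s" by linarith
  also have "\<dots> \<le> norm (cis \<tau> - 1)"
  proof (rule power2_le_imp_le)
    have "cos \<tau> = cos (2 * s)" by (simp add: s_def)
    also have "\<dots> = 1 - 2 * (sin s)\<^sup>2" by (simp add: cos_double_sin)
    finally have "cos \<tau> = 1 - 2 * (sin s)\<^sup>2" .
    moreover have "(norm (cis \<tau> - 1))\<^sup>2 = 2 - 2 * cos \<tau>"
      using sin_cos_squared_add[of \<tau>] unfolding cmod_power2 by (simp add: power2_eq_square algebra_simps)
    ultimately show "(2 * sin s)\<^sup>2 \<le> (norm (cis \<tau> - 1))\<^sup>2" by (simp add: power_mult_distrib)
  qed simp
  finally show ?thesis by (simp add: s_def)
qed

lemma norm_cis_minus_rcis: "norm (cis t - rcis r \<theta>) = norm (cis (t - \<theta>) - of_real r)"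
proof -
  have "cis t - rcis r \<theta> = cis \<theta> * (cis (t - \<theta>) - of_real r)"
    by (simp add: rcis_def algebra_simps cis_mult)
  then show ?thesis by (simp add: norm_mult)
qed

lemma norm_cis_diff_le: "norm (cis s - cis t) \<le> \<bar>s - t\<bar>"
proof -
  define u where "u = (s - t) / 2"
  have u: "s - t = 2 * u" by (simp add: u_def)
  have "norm (cis (2 * u) - 1) \<le> \<bar>2 * u\<bar>"
  proof (rule power2_le_imp_le)
    have "(norm (cis (2 * u) - 1))\<^sup>2 = 2 - 2 * cos (2 * u)"
      using sin_cos_squared_add[of "2 * u"] unfolding cmod_power2
      by (simp add: power2_eq_square algebra_simps)
    also have "\<dots> = 4 * \<bar>sin u\<bar>\<^sup>2" by (simp add: cos_double_sin)
    also have "\<dots> \<le> 4 * \<bar>u\<bar>\<^sup>2"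
      by (intro mult_left_mono power_mono abs_sin_x_le_abs_x) auto
    finally show "(norm (cis (2 * u) - 1))\<^sup>2 \<le> \<bar>2 * u\<bar>\<^sup>2" by (simp add: power_mult_distrib)
  qed simp
  then have "norm (cis (s - t) - 1) \<le> \<bar>s - t\<bar>" by (simp add: u)
  then show ?thesis using norm_cis_minus_rcis[of s 1 t] by (simp add: rcis_def)
qed

text \<open>On one period around its centre the Poisson kernel is dominated by a Cauchy kernel whose width is the
distance of the point from the circle: the distance \<open>\<bar>cis t - w\<bar>\<close> controls both that width and,
through the chord, the difference of the angles.\<close>

lemma poisson_kernel_le_cauchy_kernel:
  assumes r: "0 \<le> r" "r < 1" and t: "\<bar>t - \<theta>\<bar> \<le> pi"
  shows "poisson_kernel (rcis r \<theta>) t \<le> 32 * cauchy_kernel \<theta> (1 - r) t"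
proof -
  define n where "n = norm (cis (t - \<theta>) - of_real r)"
  have "norm (of_real r - 1 :: complex) = 1 - r"
    using r by (metis abs_minus_commute abs_of_pos diff_gt_0_iff_gt norm_of_real of_real_1 of_real_diff)
  then have "1 - r \<le> n"
    using norm_triangle_ineq2[of "cis (t - \<theta>)" "of_real r"] r by (simp add: n_def)
  moreover have "\<bar>t - \<theta>\<bar> / 2 \<le> n + (1 - r)"
    using chord_ge_half_angle[OF t] norm_triangle_ineq[of "cis (t - \<theta>) - of_real r" "of_real r - 1"]
      \<open>norm (of_real r - 1 :: complex) = 1 - r\<close> by (simp add: n_def)
  ultimately have n: "1 - r \<le> n" "\<bar>t - \<theta>\<bar> \<le> 4 * n" by auto
  have "(1 - r)\<^sup>2 \<le> n\<^sup>2" using n r by (intro power_mono) auto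
  moreover have "\<bar>t - \<theta>\<bar>\<^sup>2 \<le> (4 * n)\<^sup>2" using n by (intro power_mono) auto
  then have "(t - \<theta>)\<^sup>2 \<le> 16 * n\<^sup>2" by (simp add: power_mult_distrib)
  ultimately have D: "(t - \<theta>)\<^sup>2 + (1 - r)\<^sup>2 \<le> 32 * n\<^sup>2" using zero_le_power2[of n] by linarith
  have D0: "0 < (t - \<theta>)\<^sup>2 + (1 - r)\<^sup>2" using r by (intro add_nonneg_pos) auto
  have "poisson_kernel (rcis r \<theta>) t = (1 - r\<^sup>2) / (2 * n\<^sup>2)"
    using r by (simp add: poisson_kernel_def norm_cis_minus_rcis n_def)
  also have "\<dots> \<le> (2 * (1 - r)) / (2 * n\<^sup>2)"
  proof (intro divide_right_mono)
    have "0 \<le> (1 - r)\<^sup>2" by simp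
    then show "1 - r\<^sup>2 \<le> 2 * (1 - r)" by (simp add: power2_eq_square algebra_simps)
  qed simp
  also have "\<dots> = (1 - r) * (32 / (32 * n\<^sup>2))"
  proof -
    have "n \<noteq> 0" using n r by auto
    then show ?thesis by (simp add: field_simps)
  qed
  also have "\<dots> \<le> (1 - r) * (32 / ((t - \<theta>)\<^sup>2 + (1 - r)\<^sup>2))"
    using r D D0 by (intro mult_left_mono divide_left_mono mult_pos_pos) auto
  finally show ?thesis by (simp add: cauchy_kernel_def mult.commute)
qed

text \<open>On an arc of half length \<open>d\<close>, the Poisson kernel at a point at depth comparable to \<open>d\<close> below the
centre is at least a fixed multiple of \<open>1 / d\<close>. The depth is \<open>d / 4\<close> and not \<open>d\<close> so that
the point stays at a positive radius even for the full circle, where \<open>d = pi\<close>.\<close>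

lemma poisson_kernel_ge:
  assumes d: "0 < d" "d \<le> pi" and t: "\<bar>t - \<theta>\<bar> \<le> d"
  shows "2 / (25 * d) \<le> poisson_kernel (rcis (1 - d / 4) \<theta>) t"
proof -
  define r where "r = 1 - d / 4"
  have r: "0 < r" "r < 1" "1 - r = d / 4" using d pi_less_4 by (auto simp: r_def)
  define n where "n = norm (cis (t - \<theta>) - of_real r)"
  have "norm (1 - of_real r :: complex) = 1 - r"
    using r by (metis abs_of_pos diff_gt_0_iff_gt norm_of_real of_real_1 of_real_diff)
  moreover have "norm (cis (t - \<theta>) - 1) \<le> d" using norm_cis_diff_le[of "t - \<theta>" 0] t by simp
  ultimately have "n \<le> 5 / 4 * d"
    using norm_triangle_ineq[of "cis (t - \<theta>) - 1" "1 - of_real r"] r by (simp add: n_def)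
  moreover have "0 \<le> n" by (simp add: n_def)
  ultimately have "n\<^sup>2 \<le> (5 / 4 * d)\<^sup>2" by (intro power_mono)
  then have n: "n\<^sup>2 \<le> 25 / 16 * d\<^sup>2" by (simp add: power_divide power_mult_distrib)
  have "1 - r \<le> n" using norm_triangle_ineq2[of "cis (t - \<theta>)" "of_real r"] r by (simp add: n_def)
  then have n0: "0 < n\<^sup>2" using r by auto
  have "2 / (25 * d) = (d / 4) / (2 * (25 / 16 * d\<^sup>2))"
    using d by (simp add: field_simps power2_eq_square)
  also have "\<dots> \<le> (d / 4) / (2 * n\<^sup>2)" using d n n0 by (intro divide_left_mono) auto
  also have "\<dots> \<le> (1 - r\<^sup>2) / (2 * n\<^sup>2)"
  proof (intro divide_right_mono)
    have "r * r \<le> r" using r by (simp add: mult_left_le)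
    then show "d / 4 \<le> 1 - r\<^sup>2" using r unfolding power2_eq_square by linarith
  qed simp
  also have "\<dots> = poisson_kernel (rcis r \<theta>) t"
    using r by (simp add: poisson_kernel_def norm_cis_minus_rcis n_def)
  finally show ?thesis by (simp add: r_def)
qed

lemma poisson_kernel_nonneg: "norm w \<le> 1 \<Longrightarrow> 0 \<le> poisson_kernel w t"
  unfolding poisson_kernel_def by (simp add: abs_square_le_1)

lemma continuous_on_poisson_kernel: "norm w < 1 \<Longrightarrow> continuous_on S (poisson_kernel w)"
  unfolding poisson_kernel_def by (intro continuous_intros) (metis (no_types) eq_iff_diff_eq_0 mult_eq_0_iff norm_cis norm_eq_zero less_irrefl power_eq_0_iff zero_neq_numeral)

lemma poisson_kernel_periodic: "poisson_kernel w (t + 2 * pi) = poisson_kernel w t"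
  unfolding poisson_kernel_def by (simp flip: cis_mult)

lemma absolutely_integrable_dist_mult_continuous:
  fixes f :: "real \<Rightarrow> complex" and k :: "real \<Rightarrow> real"
  assumes f: "f absolutely_integrable_on {a..b}" and k: "continuous_on {a..b} k"
  shows "(\<lambda>x. norm (f x - c) * k x) absolutely_integrable_on {a..b}"
proof -
  have "(\<lambda>x. k x * norm (f x - c)) absolutely_integrable_on {a..b}"
  proof (rule absolutely_integrable_bounded_measurable_product_real[OF _ _ _ absolutely_integrable_dist[OF f]])
    show "k \<in> borel_measurable (lebesgue_on {a..b})"
      using k by (intro continuous_imp_measurable_on_sets_lebesgue) auto
    show "bounded (k ` {a..b})"
      using k by (intro compact_imp_bounded compact_continuous_image) auto
  qed simp
  then show ?thesis by (simp add: mult.commute)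
qed

text \<open>From the circle to the line. An interval with centre \<open>x\<^sub>0\<close> and half length \<open>y\<close> corresponds to the
point \<open>x\<^sub>0 + \<i> y\<close> of the half plane, whose image \<open>w\<close> in the disc has distance \<open>d\<close> from the circle. The
integral of \<open>\<bar>F - c\<bar>\<close> against the Poisson kernel at \<open>w\<close>, where \<open>c\<close> is the mean of \<open>F\<close> over an arc of
half length \<open>d\<close>, is bounded by \<open>poisson_kernel_le_cauchy_kernel\<close> and \<open>cauchy_kernel_bound\<close>; moved to the line it becomes an integral against
the Cauchy kernel at \<open>x\<^sub>0 + \<i> y\<close>, which is at least \<open>1 / (2 * y)\<close> on the interval.\<close>

lemma mean_osc_comp_angle_le:
  assumes per: "\<And>t. F (t + 2 * pi) = F t" and F: "locally_integrable F"
    and B: "\<And>a b. a < b \<Longrightarrow> mean_osc F a b \<le> B" and ab: "a < b"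
  shows "mean_osc (\<lambda>x. F (angle x)) a b \<le> 3072 * B"
proof -
  define x\<^sub>0 where "x\<^sub>0 = (a + b) / 2"
  define y where "y = (b - a) / 2"
  have y: "y > 0" using ab by (simp add: y_def)
  define w where "w = cayley (Complex x\<^sub>0 y)"
  define \<theta> where "\<theta> = Arg w"
  define d where "d = 1 - norm w"
  have w1: "norm w < 1" unfolding w_def using y by (intro norm_cayley_less_1) simp
  have w: "w = rcis (norm w) \<theta>" by (simp add: \<theta>_def rcis_cmod_Arg)
  have d: "d > 0" using w1 by (simp add: d_def)
  define c where "c = interval_mean F (\<theta> - d) (\<theta> + d)"
  have Fi: "F absolutely_integrable_on {a..b}" for a b using F by (rule locally_integrableD)
  have Hi: "(\<lambda>x. F (angle x)) absolutely_integrable_on {a..b}" for a b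
    by (intro locally_integrableD locally_integrable_comp_angle F)
  define \<phi> where "\<phi> t = norm (F t - c) * poisson_kernel w t" for t
  have \<phi>i: "\<phi> absolutely_integrable_on {a..b}" for a b
    unfolding \<phi>_def
    by (intro absolutely_integrable_dist_mult_continuous Fi continuous_on_poisson_kernel w1)
  have \<phi>i': "\<phi> integrable_on {a..b}" for a b
    using \<phi>i by (rule set_lebesgue_integral_eq_integral)
  let ?C = "\<lambda>t. norm (F t - c) * cauchy_kernel \<theta> d t"
  note C = cauchy_kernel_bound[OF F B d, of \<theta>, folded c_def]
  have Ci: "?C integrable_on UNIV" using C(1) by (rule set_lebesgue_integral_eq_integral)
  then have Ci': "?C integrable_on {a..b}" for a b by (rule integrable_on_subinterval) auto
  have "integral {0..2 * pi} \<phi> = integral {\<theta> - pi..\<theta> - pi + 2 * pi} \<phi>"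
    by (rule periodic_integral_eq[symmetric])
       (use per poisson_kernel_periodic \<phi>i' in \<open>auto simp: \<phi>_def\<close>)
  also have "\<dots> \<le> integral {\<theta> - pi..\<theta> - pi + 2 * pi} (\<lambda>t. 32 * ?C t)"
  proof (rule integral_le[OF \<phi>i'])
    fix t assume "t \<in> {\<theta> - pi..\<theta> - pi + 2 * pi}"
    then have "poisson_kernel w t \<le> 32 * cauchy_kernel \<theta> d t"
      using w1 by (subst w, unfold d_def, intro poisson_kernel_le_cauchy_kernel) auto
    then have "norm (F t - c) * poisson_kernel w t \<le> norm (F t - c) * (32 * cauchy_kernel \<theta> d t)"
      by (intro mult_left_mono) auto
    then show "\<phi> t \<le> 32 * ?C t" by (simp add: \<phi>_def algebra_simps)
  qed (use Ci' in auto)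
  also have "\<dots> \<le> 32 * integral UNIV ?C"
    using Ci Ci' cauchy_kernel_nonneg[OF d]
    by (simp, intro integral_subset_le) (auto intro!: mult_nonneg_nonneg)
  also have "\<dots> \<le> 1536 * B" using C(2) by simp
  finally have \<phi>: "integral {0..2 * pi} \<phi> \<le> 1536 * B" .
  let ?K = "\<lambda>x. norm (F (angle x) - c) * cauchy_kernel x\<^sub>0 y x"
  have K_eq: "?K = (\<lambda>x. 2 / (1 + x\<^sup>2) * \<phi> (angle x))"
    unfolding \<phi>_def w_def by (rule ext) (simp add: cauchy_kernel_eq_poisson_kernel[OF y])
  have K: "?K absolutely_integrable_on UNIV" "integral UNIV ?K = integral {0..2 * pi} \<phi>"
    using change_of_variables_angle[of \<phi> "integral {0..2 * pi} \<phi>"] \<phi>i unfolding K_eq by auto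
  have Ki: "?K integrable_on UNIV" using K(1) by (rule set_lebesgue_integral_eq_integral)
  have "integral {a..b} (\<lambda>x. norm (F (angle x) - c) * (1 / (2 * y))) \<le> integral {a..b} ?K"
  proof (rule integral_le)
    show "?K integrable_on {a..b}" using Ki by (rule integrable_on_subinterval) auto
    show "(\<lambda>x. norm (F (angle x) - c) * (1 / (2 * y))) integrable_on {a..b}"
      using integrable_dist[OF Hi] by (rule integrable_on_mult_left)
    fix x assume "x \<in> {a..b}"
    then have "\<bar>x - x\<^sub>0\<bar> \<le> y" by (auto simp: x\<^sub>0_def y_def abs_le_iff field_simps)
    then have "\<bar>x - x\<^sub>0\<bar>\<^sup>2 \<le> y\<^sup>2" by (intro power_mono) auto
    then have "y / (2 * y\<^sup>2) \<le> cauchy_kernel x\<^sub>0 y x"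
      unfolding cauchy_kernel_def using y by (intro divide_left_mono) (auto intro!: mult_pos_pos add_nonneg_pos)
    then have "1 / (2 * y) \<le> cauchy_kernel x\<^sub>0 y x" using y by (simp add: power2_eq_square)
    then show "norm (F (angle x) - c) * (1 / (2 * y)) \<le> ?K x" by (intro mult_left_mono) auto
  qed
  also have "\<dots> \<le> integral UNIV ?K"
    using Ki cauchy_kernel_nonneg[OF y]
    by (intro integral_subset_le integrable_on_subinterval[OF Ki]) (auto intro!: mult_nonneg_nonneg)
  also have "\<dots> \<le> 1536 * B" using K(2) \<phi> by simp
  finally have "integral {a..b} (\<lambda>x. norm (F (angle x) - c)) \<le> 1536 * B * (b - a)"
    using y by (simp add: y_def field_simps)
  then show ?thesis using mean_osc_le_of_dist_const[OF Hi ab, of c "1536 * B"] by simp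
qed

text \<open>From the line to the circle, by the same argument in the opposite direction: \<open>cauchy_kernel_bound\<close> is
applied on the line, and \<open>poisson_kernel_ge\<close> recovers the arc from the kernel. Arcs through the point 1
need no separate treatment, since the integrand has period \<open>2 * pi\<close>.\<close>

lemma mean_osc_arc_le:
  assumes per: "\<And>t. F (t + 2 * pi) = F t" and F: "locally_integrable F"
    and B: "\<And>a b. a < b \<Longrightarrow> mean_osc (\<lambda>x. F (angle x)) a b \<le> B"
    and ab: "a < b" "b \<le> a + 2 * pi"
  shows "mean_osc F a b \<le> 600 * B"
proof -
  define \<theta> where "\<theta> = (a + b) / 2"
  define d where "d = (b - a) / 2"
  have d: "0 < d" "d \<le> pi" using ab by (auto simp: d_def)
  define w where "w = rcis (1 - d / 4) \<theta>"
  have w1: "norm w < 1" using d pi_less_4 by (simp add: w_def)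
  then obtain x\<^sub>0 y where y: "y > 0" and z: "cayley (Complex x\<^sub>0 y) = w"
    using cayley_surj_disc by blast
  define c where "c = interval_mean (\<lambda>x. F (angle x)) (x\<^sub>0 - y) (x\<^sub>0 + y)"
  have Fi: "F absolutely_integrable_on {a..b}" for a b using F by (rule locally_integrableD)
  define \<phi> where "\<phi> t = norm (F t - c) * poisson_kernel w t" for t
  have \<phi>i: "\<phi> integrable_on {a..b}" for a b
    unfolding \<phi>_def
    by (intro set_lebesgue_integral_eq_integral(1) absolutely_integrable_dist_mult_continuous
        Fi continuous_on_poisson_kernel w1)
  have \<phi>0: "0 \<le> \<phi> t" for t
    using w1 poisson_kernel_nonneg[of w t] by (simp add: \<phi>_def)
  let ?K = "\<lambda>x. norm (F (angle x) - c) * cauchy_kernel x\<^sub>0 y x"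
  note K = cauchy_kernel_bound[OF locally_integrable_comp_angle[OF F] B y, of x\<^sub>0, folded c_def]
  have K_eq: "?K = (\<lambda>x. 2 / (1 + x\<^sup>2) * \<phi> (angle x))"
    unfolding \<phi>_def z[symmetric] by (rule ext) (simp add: cauchy_kernel_eq_poisson_kernel[OF y])
  have "integral {0..2 * pi} \<phi> = integral UNIV ?K"
    using change_of_variables_angle[of \<phi> "integral UNIV ?K"] K(1) unfolding K_eq by auto
  then have \<phi>: "integral {0..2 * pi} \<phi> \<le> 48 * B" using K(2) by simp
  have "integral {a..b} (\<lambda>t. norm (F t - c) * (2 / (25 * d))) \<le> integral {a..b} \<phi>"
  proof (rule integral_le[OF _ \<phi>i])
    show "(\<lambda>t. norm (F t - c) * (2 / (25 * d))) integrable_on {a..b}"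
      using integrable_dist[OF Fi] by (rule integrable_on_mult_left)
    fix t assume "t \<in> {a..b}"
    then have "\<bar>t - \<theta>\<bar> \<le> d" by (auto simp: \<theta>_def d_def abs_le_iff field_simps)
    then have "2 / (25 * d) \<le> poisson_kernel w t"
      unfolding w_def by (intro poisson_kernel_ge d)
    then show "norm (F t - c) * (2 / (25 * d)) \<le> \<phi> t" unfolding \<phi>_def by (intro mult_left_mono) auto
  qed
  also have "\<dots> \<le> integral {a..a + 2 * pi} \<phi>"
    using ab \<phi>0 by (intro integral_subset_le \<phi>i) auto
  also have "\<dots> = integral {0..2 * pi} \<phi>"
    by (rule periodic_integral_eq)
       (use per poisson_kernel_periodic \<phi>i in \<open>auto simp: \<phi>_def\<close>)
  also note \<phi>
  finally have "integral {a..b} (\<lambda>x. norm (F x - c)) \<le> 300 * B * (b - a)"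
    using d by (simp add: d_def field_simps)
  then show ?thesis using mean_osc_le_of_dist_const[OF Fi ab(1), of c "300 * B"] by simp
qed

section \<open>Approximation by continuous functions\<close>

text \<open>The average over a moving window is a difference of two values of an indefinite integral. The integral
needs a fixed lower end, so continuity is shown on each bounded interval.\<close>

lemma continuous_on_steklov_mean:
  assumes F: "locally_integrable F" and \<eta>: "\<eta> > 0"
  shows "continuous_on UNIV (\<lambda>t. interval_mean F (t - \<eta>) (t + \<eta>))"
proof -
  have Fi: "F absolutely_integrable_on {a..b}" for a b using F by (rule locally_integrableD)
  have Fi': "F integrable_on {a..b}" for a b using Fi by (rule set_lebesgue_integral_eq_integral)
  have "continuous_on {- M<..<M} (\<lambda>t. interval_mean F (t - \<eta>) (t + \<eta>))" for M
  proof -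
    define \<Phi> where "\<Phi> t = integral {- M - \<eta>..t} F" for t
    have cont: "continuous_on {- M - \<eta>..M + \<eta>} \<Phi>"
      unfolding \<Phi>_def by (rule indefinite_integral_continuous_1[OF Fi'])
    have c1: "continuous_on {- M<..<M} (\<lambda>t. \<Phi> (t + \<eta>))"
      by (rule continuous_on_compose2[OF cont]) (use \<eta> in \<open>auto intro!: continuous_intros\<close>)
    have c2: "continuous_on {- M<..<M} (\<lambda>t. \<Phi> (t - \<eta>))"
      by (rule continuous_on_compose2[OF cont]) (use \<eta> in \<open>auto intro!: continuous_intros\<close>)
    have "interval_mean F (t - \<eta>) (t + \<eta>) = (1 / (2 * \<eta>)) *\<^sub>R (\<Phi> (t + \<eta>) - \<Phi> (t - \<eta>))"
      if "t \<in> {- M<..<M}" for t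
    proof -
      have "\<Phi> (t + \<eta>) = \<Phi> (t - \<eta>) + integral {t - \<eta>..t + \<eta>} F"
        unfolding \<Phi>_def using that \<eta> Fi'
        by (intro Henstock_Kurzweil_Integration.integral_combine[symmetric]) auto
      then show ?thesis by (simp add: interval_mean_eq[OF Fi])
    qed
    moreover have "continuous_on {- M<..<M} (\<lambda>t. (1 / (2 * \<eta>)) *\<^sub>R (\<Phi> (t + \<eta>) - \<Phi> (t - \<eta>)))"
      by (intro continuous_on_scaleR continuous_on_const continuous_on_diff c1 c2)
    ultimately show ?thesis by (subst continuous_on_cong[OF refl]) auto
  qed
  then have "continuous_on (\<Union>n. {- real n<..<real n}) (\<lambda>t. interval_mean F (t - \<eta>) (t + \<eta>))"
    by (intro continuous_on_open_UN) auto
  moreover have "t \<in> (\<Union>n. {- real n<..<real n})" for t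
  proof -
    obtain n where "\<bar>t\<bar> < real n" using reals_Archimedean2 by blast
    then have "t \<in> {- real n<..<real n}" by auto
    then show ?thesis by blast
  qed
  then have "(\<Union>n. {- real n<..<real n}) = UNIV" by blast
  ultimately show ?thesis by simp
qed

lemma steklov_mean_periodic:
  assumes "\<And>t. F (t + p) = F t" and F: "locally_integrable F"
  shows "interval_mean F (t + p - \<eta>) (t + p + \<eta>) = interval_mean F (t - \<eta>) (t + \<eta>)"
proof -
  have "integral {t + p - \<eta>..t + p + \<eta>} F = integral {t - \<eta>..t + \<eta>} F"
  proof -
    have "t - \<eta> + p = t + p - \<eta>" "t + \<eta> + p = t + p + \<eta>" "F \<circ> (+) p = F"
      using assms(1) by (auto simp: o_def add.commute[of p])
    then show ?thesis using integral_shift_Icc_real[of "t - \<eta>" "t + \<eta>" F p] by (simp only:)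
  qed
  then show ?thesis using locally_integrableD[OF F] by (simp add: interval_mean_eq)
qed

text \<open>Only oscillations at scales up to \<open>3 * \<eta>\<close> are assumed small, but the conclusion holds at all scales.
All windows centred in an interval of length at most \<open>\<eta>\<close> lie in a common interval of length at most
\<open>3 * \<eta>\<close>, so on it the window average \<open>\<psi>\<close> stays near one constant. For short intervals this bounds the
oscillations of \<open>F\<close> and \<open>\<psi>\<close> separately; at scale \<open>\<eta>\<close> it bounds the mean of \<open>\<bar>F - \<psi>\<bar>\<close> itself, and
covering extends this bound to longer intervals.\<close>

lemma mean_osc_diff_steklov_mean_le:
  fixes F :: "real \<Rightarrow> complex"
  assumes F: "locally_integrable F" and \<eta>: "\<eta> > 0"
    and \<epsilon>: "\<And>a b. a < b \<Longrightarrow> b - a \<le> 3 * \<eta> \<Longrightarrow> mean_osc F a b \<le> \<epsilon>"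
    and ab: "a < b"
  defines "\<psi> \<equiv> \<lambda>t. interval_mean F (t - \<eta>) (t + \<eta>)"
  shows "mean_osc (\<lambda>t. F t - \<psi> t) a b \<le> 18 * \<epsilon>"
proof -
  have Fi: "F absolutely_integrable_on {a..b}" for a b using F by (rule locally_integrableD)
  have \<psi>: "locally_integrable \<psi>"
    unfolding \<psi>_def by (intro locally_integrable_continuous continuous_on_steklov_mean F \<eta>)
  have \<psi>i: "\<psi> absolutely_integrable_on {a..b}" for a b using \<psi> by (rule locally_integrableD)
  have Di: "(\<lambda>t. F t - \<psi> t) absolutely_integrable_on {a..b}" for a b
    using Fi \<psi>i by (rule set_integral_diff)
  have \<epsilon>0: "0 \<le> \<epsilon>" using mean_osc_nonneg[of 0 \<eta> F] \<epsilon>[of 0 \<eta>] \<eta> by simp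
  \<comment> \<open>The mean over the union of all windows centred in the interval from p to q.\<close>
  define m where "m p q = interval_mean F (p - \<eta>) (q + \<eta>)" for p q
  have osc: "integral {p - \<eta>..q + \<eta>} (\<lambda>x. norm (F x - m p q)) \<le> 3 * \<eta> * \<epsilon>"
    if "p < q" "q - p \<le> \<eta>" for p q
  proof -
    have "integral {p - \<eta>..q + \<eta>} (\<lambda>x. norm (F x - m p q)) = (q - p + 2 * \<eta>) * mean_osc F (p - \<eta>) (q + \<eta>)"
      using integral_dist_mean[OF Fi, of "p - \<eta>" "q + \<eta>"] that \<eta> by (simp add: m_def)
    also have "\<dots> \<le> (3 * \<eta>) * \<epsilon>"
      using that \<eta> \<epsilon>0 by (intro mult_mono \<epsilon> mean_osc_nonneg) auto
    finally show ?thesis .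
  qed
  have close: "norm (\<psi> t - m p q) \<le> 3 / 2 * \<epsilon>"
    if pq: "p < q" "q - p \<le> \<eta>" and t: "t \<in> {p..q}" for p q t
  proof -
    have "2 * \<eta> * norm (\<psi> t - m p q) \<le> integral {t - \<eta>..t + \<eta>} (\<lambda>x. norm (F x - m p q))"
      using dist_interval_mean_le[OF Fi, of "t - \<eta>" "t + \<eta>" "m p q"] \<eta> by (simp add: \<psi>_def)
    also have "\<dots> \<le> integral {p - \<eta>..q + \<eta>} (\<lambda>x. norm (F x - m p q))"
      using t by (intro integral_subset_le integrable_dist Fi) auto
    also have "\<dots> \<le> 3 * \<eta> * \<epsilon>" by (rule osc[OF pq])
    finally show ?thesis using \<eta> by simp
  qed
  show ?thesis
  proof (cases "b - a \<le> \<eta>")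
    case True
    have "mean_osc (\<lambda>t. - \<psi> t) a b \<le> 2 * (3 / 2 * \<epsilon>)"
    proof (rule mean_osc_le_sup_dist[OF _ ab])
      show "(\<lambda>t. - \<psi> t) absolutely_integrable_on {a..b}"
        using set_integral_diff(1)[OF absolutely_integrable_zero \<psi>i] by simp
      show "norm (- \<psi> t - (- m a b)) \<le> 3 / 2 * \<epsilon>" if "t \<in> {a..b}" for t
        using close[OF ab True that] by (simp add: norm_minus_commute)
    qed
    moreover have "mean_osc F a b \<le> \<epsilon>" using ab True \<eta> by (intro \<epsilon>) auto
    moreover have "mean_osc (\<lambda>t. F t - \<psi> t) a b \<le> mean_osc F a b + mean_osc (\<lambda>t. - \<psi> t) a b"
      using mean_osc_add_le[OF Fi[of a b], of "\<lambda>t. - \<psi> t"] ab set_integral_diff(1)[OF absolutely_integrable_zero \<psi>i] by simp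
    ultimately show ?thesis using \<epsilon>0 by linarith
  next
    case False
    have "integral {p..p + \<eta>} (\<lambda>x. norm (F x - \<psi> x)) \<le> 9 / 2 * \<epsilon> * \<eta>" for p
    proof -
      let ?c = "m p (p + \<eta>)"
      have "integral {p..p + \<eta>} (\<lambda>x. norm (F x - \<psi> x))
          \<le> integral {p..p + \<eta>} (\<lambda>x. norm (F x - ?c) + 3 / 2 * \<epsilon>)"
      proof (rule integral_le)
        show "(\<lambda>x. norm (F x - \<psi> x)) integrable_on {p..p + \<eta>}"
          using integrable_dist[OF Di, where c = 0] by simp
        show "(\<lambda>x. norm (F x - ?c) + 3 / 2 * \<epsilon>) integrable_on {p..p + \<eta>}"
          by (intro integrable_add integrable_dist Fi) auto
        fix x assume "x \<in> {p..p + \<eta>}"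
        then have "norm (\<psi> x - ?c) \<le> 3 / 2 * \<epsilon>" using \<eta> by (intro close) auto
        then show "norm (F x - \<psi> x) \<le> norm (F x - ?c) + 3 / 2 * \<epsilon>"
          using norm_triangle_ineq4[of "F x - ?c" "\<psi> x - ?c"] by simp
      qed
      also have "\<dots> = integral {p..p + \<eta>} (\<lambda>x. norm (F x - ?c)) + 3 / 2 * \<epsilon> * \<eta>"
        using \<eta> integrable_dist[OF Fi] by (subst integral_add) auto
      also have "integral {p..p + \<eta>} (\<lambda>x. norm (F x - ?c))
          \<le> integral {p - \<eta>..(p + \<eta>) + \<eta>} (\<lambda>x. norm (F x - ?c))"
        using \<eta> by (intro integral_subset_le integrable_dist Fi) auto
      also have "\<dots> \<le> 3 * \<eta> * \<epsilon>" using \<eta> by (intro osc) auto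
      finally show ?thesis by (simp add: algebra_simps)
    qed
    then have "integral {a..b} (\<lambda>x. norm (F x - \<psi> x)) \<le> 2 * (9 / 2 * \<epsilon>) * (b - a)"
      using False \<eta> integrable_dist[OF Di, where c = 0] by (intro integral_le_of_unit_intervals[of _ \<eta>]) auto
    then show ?thesis using mean_osc_le_of_dist_const[OF Di ab, of 0 "9 * \<epsilon>"] by simp
  qed
qed

lemma approx_by_compactly_supported:
  fixes u :: "real \<Rightarrow> complex"
  assumes u: "continuous_on UNIV u" and "(u \<longlongrightarrow> 0) at_top" "(u \<longlongrightarrow> 0) at_bot" and e: "e > 0"
  obtains g where "g \<in> Cc_real" "\<And>x. norm (u x - g x) \<le> e"
proof -
  have "\<forall>\<^sub>F x in at_top. norm (u x) < e" "\<forall>\<^sub>F x in at_bot. norm (u x) < e"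
    using assms(2,3) e by (auto dest!: tendstoD[of u 0 _ e])
  then obtain a b where ab: "\<And>x. x \<ge> a \<Longrightarrow> norm (u x) < e" "\<And>x. x \<le> b \<Longrightarrow> norm (u x) < e"
    by (auto simp: eventually_at_top_linorder eventually_at_bot_linorder)
  define M where "M = max \<bar>a\<bar> \<bar>b\<bar>"
  have M: "norm (u x) < e" if "\<bar>x\<bar> \<ge> M" for x
  proof -
    have "x \<ge> a \<or> x \<le> b" using that unfolding M_def by linarith
    then show ?thesis using ab by blast
  qed
  \<comment> \<open>A continuous cut-off, 1 on the interval of radius M and 0 outside radius M + 1.\<close>
  define cut where "cut x = max 0 (min 1 (M + 1 - \<bar>x\<bar>))" for x :: real
  define g where "g x = cut x *\<^sub>R u x" for x
  have cut: "0 \<le> cut x" "cut x \<le> 1" for x by (auto simp: cut_def)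
  have "continuous_on UNIV g"
    unfolding g_def cut_def by (intro continuous_intros u)
  moreover have "compact (closure {x. g x \<noteq> 0})"
  proof -
    have "{x. g x \<noteq> 0} \<subseteq> {- (M + 1)..M + 1}" by (auto simp: g_def cut_def)
    then show ?thesis
      using bounded_subset[OF bounded_closed_interval] by (simp add: compact_closure) blast
  qed
  moreover have "norm (u x - g x) \<le> e" for x
  proof (cases "\<bar>x\<bar> \<ge> M")
    case True
    have "u x - g x = (1 - cut x) *\<^sub>R u x" by (simp add: g_def algebra_simps)
    then have "norm (u x - g x) = (1 - cut x) * norm (u x)" using cut[of x] by simp
    also have "\<dots> \<le> norm (u x)" using cut[of x] by (intro mult_left_le_one_le) auto
    finally show ?thesis using M[OF True] by simp
  next
    case False
    then show ?thesis using e by (simp add: g_def cut_def)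
  qed
  ultimately show ?thesis using that by (auto simp: Cc_real_def)
qed

lemma tendsto_angle_at_top: "(angle \<longlongrightarrow> 2 * pi) at_top"
proof -
  have "(angle \<longlongrightarrow> pi + 2 * (pi / 2)) at_top"
    unfolding angle_def by (intro tendsto_intros tendsto_arctan_at_top)
  then show ?thesis by simp
qed

lemma tendsto_angle_at_bot: "(angle \<longlongrightarrow> 0) at_bot"
proof -
  have "(angle \<longlongrightarrow> pi + 2 * (- (pi / 2))) at_bot"
    unfolding angle_def by (intro tendsto_intros tendsto_arctan_at_bot)
  then show ?thesis by simp
qed

text \<open>A point of the circle near 1 comes from a real number of large absolute value, where \<open>g\<close> vanishes;
hence 0 is the continuous value at 1.\<close>

lemma continuous_extension_to_circle:
  assumes g: "g \<in> Cc_real"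
  obtains \<psi> where "continuous_on (sphere 0 1) \<psi>" "\<And>x. \<psi> (cayley (complex_of_real x)) = g x"
proof -
  \<comment> \<open>The inverse of the Cayley transform; on the circle its values are real.\<close>
  define \<sigma> where "\<sigma> z = Re (\<i> * (1 + z) / (1 - z))" for z :: complex
  define \<psi> where "\<psi> z = (if z = 1 then 0 else g (\<sigma> z))" for z
  have \<sigma>: "\<sigma> (cayley (complex_of_real x)) = x" "cayley (complex_of_real x) \<noteq> 1" for x
  proof -
    have n: "complex_of_real x + \<i> \<noteq> 0" by (rule real_plus_ii_neq_0)
    then have "1 + cayley x = 2 * x / (x + \<i>)" "1 - cayley x = 2 * \<i> / (x + \<i>)"
      by (simp_all add: cayley_def field_simps)
    then show "\<sigma> (cayley x) = x" "cayley (complex_of_real x) \<noteq> 1" using n by (auto simp: \<sigma>_def)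
  qed
  have "bounded {x. g x \<noteq> 0}"
    using g by (auto simp: Cc_real_def dest: compact_imp_bounded bounded_subset[OF _ closure_subset])
  then obtain M where M: "M > 0" "\<And>x. g x \<noteq> 0 \<Longrightarrow> \<bar>x\<bar> \<le> M"
    unfolding bounded_pos by auto
  have zero: "\<psi> z = 0" if z: "z \<in> sphere 0 1" "norm (1 - z) < 2 / (M + 1)" for z
  proof (cases "z = 1")
    case False
    define q where "q = \<i> * (1 + z) / (1 - z)"
    have "Im q = 0"
    proof -
      have "(Re z)\<^sup>2 + (Im z)\<^sup>2 = 1" using z(1) cmod_power2[of z] by simp
      then show ?thesis unfolding q_def
        by (simp add: Im_divide power2_eq_square algebra_simps)
    qed
    then have q: "norm q = \<bar>\<sigma> z\<bar>" by (simp add: \<sigma>_def q_def cmod_eq_Re)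
    \<comment> \<open>The distance to 1 of a point of the circle determines how far away its preimage is.\<close>
    have "q + \<i> = 2 * \<i> / (1 - z)" using False by (simp add: q_def field_simps)
    then have "norm (q + \<i>) = 2 / norm (1 - z)" by (simp add: norm_divide norm_mult)
    moreover have "2 / norm (1 - z) > M + 1" using z(2) M(1) False by (simp add: field_simps)
    moreover have "norm (q + \<i>) \<le> norm q + 1" using norm_triangle_ineq[of q \<i>] by simp
    ultimately have "\<bar>\<sigma> z\<bar> > M" using q by simp
    then have "g (\<sigma> z) = 0" using M(2) by fastforce
    then show ?thesis by (simp add: \<psi>_def)
  qed (simp add: \<psi>_def)
  have "continuous_on (sphere 0 1 \<inter> - {1}) \<psi>"
  proof -
    have "continuous_on (sphere 0 1 \<inter> - {1}) \<sigma>"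
      unfolding \<sigma>_def by (intro continuous_intros) auto
    then have "continuous_on (sphere 0 1 \<inter> - {1}) (\<lambda>z. g (\<sigma> z))"
      using g by (intro continuous_on_compose2[of UNIV g _ \<sigma>]) (simp_all add: Cc_real_def)
    then show ?thesis by (rule continuous_on_eq) (simp add: \<psi>_def)
  qed
  moreover have "continuous_on (sphere 0 1 \<inter> ball 1 (2 / (M + 1))) \<psi>"
    by (rule continuous_on_eq[OF continuous_on_const[of _ 0]])
       (use zero in \<open>auto simp: dist_norm\<close>)
  moreover have "sphere 0 1 = (sphere 0 1 \<inter> - {1}) \<union> (sphere 0 1 \<inter> ball 1 (2 / (M + 1)))"
    using M(1) by auto
  moreover have "openin (top_of_set (sphere 0 1)) (sphere 0 1 \<inter> - {1 :: complex})"
    "openin (top_of_set (sphere 0 1)) (sphere 0 1 \<inter> ball (1 :: complex) (2 / (M + 1)))"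
    by (intro openin_open_Int; simp add: open_Compl)+
  ultimately have "continuous_on (sphere 0 1) \<psi>"
    using continuous_on_Un_local_open[of "sphere 0 1 \<inter> - {1}" "sphere 0 1 \<inter> ball 1 (2 / (M + 1))" \<psi>]
    by metis
  then show ?thesis using that[of \<psi>] \<sigma> by (simp add: \<psi>_def)
qed

section \<open>Vanishing mean oscillation on the circle and on the line\<close>

lemma bmo_norm_le_iff: "bmo_norm f \<le> ereal C \<longleftrightarrow> (\<forall>a b. a < b \<longrightarrow> mean_osc f a b \<le> C)"
  unfolding bmo_norm_def by (auto simp: SUP_le_iff)

lemma bmo_norm_circle_finiteE:
  assumes "bmo_norm_circle f < \<infinity>"
  obtains C where "\<And>a b. a < b \<Longrightarrow> b \<le> a + 2 * pi \<Longrightarrow> mean_osc (\<lambda>t. f (cis t)) a b \<le> C"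
proof -
  have le: "ereal (mean_osc (\<lambda>t. f (cis t)) a b) \<le> bmo_norm_circle f" if "a < b" "b \<le> a + 2 * pi" for a b
    unfolding bmo_norm_circle_def arcs_def arc_mean_osc_def
    using that by (intro SUP_upper2[of "(a, b)"]) auto
  have "0 \<le> bmo_norm_circle f"
    using le[of 0 1] mean_osc_nonneg[of 0 1 "\<lambda>t. f (cis t)"] pi_ge_two by (auto intro: order_trans[rotated])
  then obtain C where "bmo_norm_circle f = ereal C" using assms by (cases "bmo_norm_circle f") auto
  then show ?thesis using that[of C] le by auto
qed

text \<open>A window average \<open>\<psi>\<close> of \<open>F\<close> is close to \<open>F\<close> in BMO, hence so are their compositions with \<open>angle\<close>. The
values of \<open>\<psi>\<close> at the angles 0 and \<open>2 * pi\<close> agree, so \<open>\<psi> \<circ> angle\<close> minus this value tends to 0 at both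
ends of the line and can be cut off.\<close>

lemma CMO_of_VMO:
  fixes f :: "complex \<Rightarrow> complex"
  defines "F \<equiv> \<lambda>t. f (cis t)"
  assumes F: "locally_integrable F" and VMO: "f \<in> VMO_circle" and e: "e > 0"
  shows "\<exists>g\<in>Cc_real. bmo_norm (\<lambda>x. F (angle x) - g x) < ereal e"
proof -
  \<comment> \<open>The final bound is 3072 * 18 * \<epsilon> from the window average plus 2 * \<epsilon> from the cut-off.\<close>
  define \<epsilon> where "\<epsilon> = e / 110600"
  have \<epsilon>: "\<epsilon> > 0" using e by (simp add: \<epsilon>_def)
  obtain \<delta> where \<delta>: "\<delta> > 0"
    and small: "\<And>a b. (a, b) \<in> arcs \<Longrightarrow> b - a < \<delta> \<Longrightarrow> mean_osc F a b < \<epsilon>"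
    using VMO \<epsilon> unfolding VMO_circle_def arc_mean_osc_def F_def by blast
  \<comment> \<open>Intervals of length at most 3 * \<eta> are then arcs shorter than \<delta>.\<close>
  define \<eta> where "\<eta> = min \<delta> pi / 4"
  have \<eta>: "\<eta> > 0" "3 * \<eta> < \<delta>" "3 * \<eta> < 2 * pi" using \<delta> pi_gt_zero by (auto simp: \<eta>_def min_def)
  have osc: "mean_osc F a b \<le> \<epsilon>" if "a < b" "b - a \<le> 3 * \<eta>" for a b
    using that \<eta> small[of a b] by (auto simp: arcs_def)
  have per: "F (t + 2 * pi) = F t" for t by (simp add: F_def flip: cis_mult)
  define \<psi> where "\<psi> t = interval_mean F (t - \<eta>) (t + \<eta>)" for t
  have \<psi>: "continuous_on UNIV \<psi>"
    unfolding \<psi>_def by (intro continuous_on_steklov_mean F \<eta>)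
  have \<psi>per: "\<psi> (t + 2 * pi) = \<psi> t" for t
    unfolding \<psi>_def using per F by (rule steklov_mean_periodic)
  have D: "locally_integrable (\<lambda>t. F t - \<psi> t)"
    by (intro locally_integrable_diff F locally_integrable_continuous \<psi>)
  have bound: "mean_osc (\<lambda>x. F (angle x) - \<psi> (angle x)) a b \<le> 3072 * (18 * \<epsilon>)" if "a < b" for a b
  proof (rule mean_osc_comp_angle_le[OF _ D _ that])
    show "mean_osc (\<lambda>t. F t - \<psi> t) a b \<le> 18 * \<epsilon>" if "a < b" for a b
      unfolding \<psi>_def using F \<eta>(1) osc that by (rule mean_osc_diff_steklov_mean_le)
  qed (simp add: per \<psi>per)
  define u where "u x = \<psi> (angle x) - \<psi> 0" for x
  have u: "continuous_on UNIV u"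
    unfolding u_def by (intro continuous_intros continuous_on_compose2[OF \<psi> continuous_on_angle]) auto
  have \<psi>_tendsto: "((\<lambda>x. \<psi> (angle x)) \<longlongrightarrow> \<psi> l) G" if "(angle \<longlongrightarrow> l) G" for l G
    using \<psi> that by (auto simp: continuous_on_eq_continuous_at intro: isCont_tendsto_compose)
  have "\<psi> (2 * pi) = \<psi> 0" using \<psi>per[of 0] by simp
  then have "(u \<longlongrightarrow> 0) at_top" "(u \<longlongrightarrow> 0) at_bot"
    unfolding u_def using \<psi>_tendsto[OF tendsto_angle_at_top] \<psi>_tendsto[OF tendsto_angle_at_bot]
    by (auto intro!: tendsto_eq_intros)
  then obtain g where g: "g \<in> Cc_real" "\<And>x. norm (u x - g x) \<le> \<epsilon>"
    using approx_by_compactly_supported[OF u _ _ \<epsilon>] by blast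
  have gc: "continuous_on UNIV g" using g(1) by (simp add: Cc_real_def)
  have "mean_osc (\<lambda>x. F (angle x) - g x) a b \<le> 55298 * \<epsilon>" if ab: "a < b" for a b
  proof -
    let ?D = "\<lambda>x. F (angle x) - \<psi> (angle x)"
    have Di: "?D absolutely_integrable_on {a..b}"
      using locally_integrable_comp_angle[OF D] by (rule locally_integrableD)
    have ugi: "(\<lambda>x. u x - g x) absolutely_integrable_on {a..b}"
      by (intro locally_integrableD locally_integrable_continuous continuous_on_diff u gc)
    have "mean_osc (\<lambda>x. F (angle x) - g x) a b = mean_osc (\<lambda>x. (?D x + (u x - g x)) + \<psi> 0) a b"
      by (simp add: u_def)
    also have "\<dots> = mean_osc (\<lambda>x. ?D x + (u x - g x)) a b"
      using Di ugi by (intro mean_osc_add_const ab set_integral_add)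
    also have "\<dots> \<le> mean_osc ?D a b + mean_osc (\<lambda>x. u x - g x) a b"
      by (intro mean_osc_add_le Di ugi ab)
    also have "mean_osc (\<lambda>x. u x - g x) a b \<le> 2 * \<epsilon>"
      using g(2) by (intro mean_osc_le_sup_dist[OF ugi ab, of 0]) simp
    finally show ?thesis using bound[OF ab] by simp
  qed
  then have "bmo_norm (\<lambda>x. F (angle x) - g x) \<le> ereal (55298 * \<epsilon>)" by (simp add: bmo_norm_le_iff)
  also have "\<dots> < ereal e" using e by (simp add: \<epsilon>_def)
  finally show ?thesis using g(1) by blast
qed

text \<open>A function \<open>g\<close> with compact support that is close to \<open>F \<circ> angle\<close> in BMO extends to a continuous function
on the circle. By conformal invariance \<open>F\<close> is close to this extension on all arcs, and on short arcs
the extension oscillates little because it is uniformly continuous.\<close>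

lemma VMO_of_CMO:
  fixes f :: "complex \<Rightarrow> complex"
  defines "F \<equiv> \<lambda>t. f (cis t)"
  assumes F: "locally_integrable F" and CMO: "(\<lambda>x. F (angle x)) \<in> CMO_real" and e: "e > 0"
  shows "\<exists>\<delta>>0. \<forall>(a, b)\<in>arcs. b - a < \<delta> \<longrightarrow> arc_mean_osc f a b < e"
proof -
  \<comment> \<open>The final bound is 600 * \<epsilon> from conformal invariance plus 2 * \<epsilon> from uniform continuity.\<close>
  define \<epsilon> where "\<epsilon> = e / 700"
  have \<epsilon>: "\<epsilon> > 0" using e by (simp add: \<epsilon>_def)
  obtain g where g: "g \<in> Cc_real" and "bmo_norm (\<lambda>x. F (angle x) - g x) < ereal \<epsilon>"
    using CMO \<epsilon> unfolding CMO_real_def by blast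
  then have osc: "mean_osc (\<lambda>x. F (angle x) - g x) a b \<le> \<epsilon>" if "a < b" for a b
    using that bmo_norm_le_iff[of "\<lambda>x. F (angle x) - g x" \<epsilon>] by (simp add: less_imp_le)
  obtain \<psi> where \<psi>: "continuous_on (sphere 0 1) \<psi>" "\<And>x. \<psi> (cayley (complex_of_real x)) = g x"
    using continuous_extension_to_circle[OF g] by blast
  define \<Psi> where "\<Psi> t = \<psi> (cis t)" for t
  have \<Psi>: "continuous_on UNIV \<Psi>"
    unfolding \<Psi>_def by (intro continuous_on_compose2[OF \<psi>(1)] continuous_intros) auto
  have \<Psi>i: "\<Psi> absolutely_integrable_on {a..b}" for a b
    by (intro locally_integrableD locally_integrable_continuous \<Psi>)
  have D: "locally_integrable (\<lambda>t. F t - \<Psi> t)"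
    by (intro locally_integrable_diff F locally_integrable_continuous \<Psi>)
  have "uniformly_continuous_on (sphere 0 1) \<psi>"
    using \<psi>(1) by (intro compact_uniformly_continuous) auto
  then obtain \<delta> where \<delta>: "\<delta> > 0"
    "\<And>z w. z \<in> sphere 0 1 \<Longrightarrow> w \<in> sphere 0 1 \<Longrightarrow> dist w z < \<delta> \<Longrightarrow> dist (\<psi> w) (\<psi> z) < \<epsilon>"
    using \<epsilon> unfolding uniformly_continuous_on_def by metis
  have "mean_osc F a b < e" if ab: "a < b" "b \<le> a + 2 * pi" "b - a < \<delta>" for a b
  proof -
    have "mean_osc (\<lambda>t. F t - \<Psi> t) a b \<le> 600 * \<epsilon>"
    proof (rule mean_osc_arc_le[OF _ D _ ab(1,2)])
      show "F (t + 2 * pi) - \<Psi> (t + 2 * pi) = F t - \<Psi> t" for t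
        by (simp add: F_def \<Psi>_def flip: cis_mult)
      show "mean_osc (\<lambda>x. F (angle x) - \<Psi> (angle x)) a b \<le> \<epsilon>" if "a < b" for a b
        using osc[OF that] by (simp add: \<Psi>_def cis_angle \<psi>(2))
    qed
    moreover have "mean_osc \<Psi> a b \<le> 2 * \<epsilon>"
    proof (rule mean_osc_le_sup_dist[OF \<Psi>i ab(1)])
      fix t assume "t \<in> {a..b}"
      then have "dist (cis t) (cis a) < \<delta>"
        using norm_cis_diff_le[of t a] ab(3) by (simp add: dist_norm)
      then show "norm (\<Psi> t - \<Psi> a) \<le> \<epsilon>"
        using \<delta>(2)[of "cis a" "cis t"] by (simp add: \<Psi>_def dist_norm less_imp_le)
    qed
    moreover have "mean_osc F a b \<le> mean_osc (\<lambda>t. F t - \<Psi> t) a b + mean_osc \<Psi> a b"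
      using mean_osc_add_le[OF locally_integrableD[OF D] \<Psi>i ab(1)] by simp
    ultimately have "mean_osc F a b \<le> 602 * \<epsilon>" by simp
    also have "\<dots> < e" using e by (simp add: \<epsilon>_def)
    finally show ?thesis .
  qed
  then show ?thesis using \<delta>(1) by (auto simp: arcs_def arc_mean_osc_def F_def)
qed

theorem theorem3p4:
  fixes f :: "complex \<Rightarrow> complex"
  assumes "f \<in> BMO_circle"
  shows "f \<in> VMO_circle \<longleftrightarrow> (\<lambda>x::real. f (cayley (complex_of_real x))) \<in> CMO_real"
proof -
  define F where "F t = f (cis t)" for t
  have per: "F (t + 2 * pi) = F t" for t by (simp add: F_def flip: cis_mult)
  have "F absolutely_integrable_on {0..2 * pi}"
    using assms by (simp add: BMO_circle_def circle_integrable_def F_def[abs_def])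
  then have F: "locally_integrable F"
    unfolding locally_integrable_iff
    using periodic_absolutely_integrable[of F "2 * pi", OF per] by simp
  obtain C where "\<And>a b. a < b \<Longrightarrow> b \<le> a + 2 * pi \<Longrightarrow> mean_osc F a b \<le> C"
    using assms bmo_norm_circle_finiteE unfolding BMO_circle_def F_def by blast
  then have "mean_osc F a b \<le> 4 * C" if "a < b" for a b
    using that by (intro mean_osc_periodic_le[OF per _ F]) auto
  then have "mean_osc (\<lambda>x. F (angle x)) a b \<le> 3072 * (4 * C)" if "a < b" for a b
    using that by (intro mean_osc_comp_angle_le[OF per F])
  then have "bmo_norm (\<lambda>x. F (angle x)) \<le> ereal (3072 * (4 * C))"
    by (simp add: bmo_norm_le_iff)
  then have "bmo_norm (\<lambda>x. F (angle x)) < \<infinity>" by (rule le_less_trans) simp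
  then have BMO: "(\<lambda>x. F (angle x)) \<in> BMO_real"
    using locally_integrable_comp_angle[OF F] by (simp add: BMO_real_def)
  have "(\<lambda>x. f (cayley (complex_of_real x))) = (\<lambda>x. F (angle x))"
    by (simp add: F_def cis_angle)
  moreover have "f \<in> VMO_circle \<longleftrightarrow> (\<lambda>x. F (angle x)) \<in> CMO_real"
  proof
    assume "f \<in> VMO_circle"
    then show "(\<lambda>x. F (angle x)) \<in> CMO_real"
      using BMO CMO_of_VMO[of f] F by (simp add: CMO_real_def F_def[abs_def])
  next
    assume "(\<lambda>x. F (angle x)) \<in> CMO_real"
    then show "f \<in> VMO_circle"
      using assms VMO_of_CMO[of f] F by (simp add: VMO_circle_def F_def[abs_def])
  qed
  ultimately show ?thesis by simp
qed

end
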